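(* Consider a multiple access channel with transmitters $1,2,\dots,k$, and let $B_1,\dots,B_k$ be the corresponding divergence transition matrices. For $n\ge 1$ let $B_{0,n}=\big[B_1^{(n)}\ \cdots\ B_k^{(n)}\big]$ (horizontal concatenation), and let $B_0=B_{0,1}$. Then the second largest singular value of $B_{0,n}$ is the same as the second largest singular value of $B_0$, for every $n$. Moreover, let $\psi=[\psi_1^T\ \cdots\ \psi_k^T]^T$, where $\psi_i$ is an $|\mathcal X_i|$-dimensional vector, be the right singular vector of $B_0$ with the second largest singular value. Then, for all $1\le i\le k$, $\psi_i$ is orthogonal to $[\sqrt{P_{X_i}(x_i)},\,x_i\in\mathcal X_i]^T$.
   Context: The multiple access channel has finite input alphabets $\mathcal X_1,\dots,\mathcal X_k$, finite output alphabet $\mathcal Y$, and transition probabilities $W(y|x_1,\dots,x_k)=P_{Y|X_1,\dots,X_k}(y|x_1,\dots,x_k)$. Input distributions $P_{X_i}$ on $\mathcal X_i$ with strictly positive entries are fixed, with $X_1,\dots,X_k$ independent; $P_Y$ is the resulting output distribution (assumed strictly positive). For each $i$ define $$W_i(y|x_i)=\sum_{(x_j)_{j\ne i}}W(y|x_1,\dots,x_k)\prod_{j\ne i}P_{X_j}(x_j),$$ and the divergence transition matrix (DTM) of transmitter $i$, of size $|\mathcal Y|\times|\mathcal X_i|$, $$B_i=\big[\sqrt{P_Y}^{-1}\big]W_i\big[\sqrt{P_{X_i}}\big],\qquad B_i(y,x_i)=\frac{W_i(y|x_i)\sqrt{P_{X_i}(x_i)}}{\sqrt{P_Y(y)}},$$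 where $[\cdot]$ denotes the diagonal matrix with the indicated entries. $B_i^{(n)}$ is the $n$-fold Kronecker power of $B_i$. Singular values are listed in decreasing order with multiplicity. The largest singular value of $B_0$ is $\sqrt k$, with left singular vector $[\sqrt{P_Y(y)},\,y\in\mathcal Y]^T$ and right singular vector proportional to $[\underline v_{1,0}^T\ \cdots\ \underline v_{k,0}^T]^T$, where $\underline v_{i,0}=[\sqrt{P_{X_i}(x_i)},\,x_i\in\mathcal X_i]^T$; the singular vector for the second largest singular value is taken orthogonal to it, as in a singular value decomposition.
   Formalization: The orthogonality claim is stated only when k = 1 or the second largest singular value of B_0 is nonzero; for k ≥ 2 and value zero it fails, e.g. for W independent of the inputs and ψ = [v_{1,0}; −v_{2,0}; 0; …]. *)

theory Defs
  imports "Jordan_Normal_Form.Char_Poly" "HOL-Library.FuncSet" "HOL.NthRoot"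
begin

text \<open>
  There are \<open>k\<close> transmitters, numbered \<open>0, \<dots>, k - 1\<close>.  The input alphabet of transmitter \<open>i\<close>
  is \<open>{..<q i}\<close> and the output alphabet is \<open>{..<r}\<close>, so that letters serve directly as matrix
  indices.  \<open>W y x\<close> is the probability of output \<open>y\<close> given the joint input \<open>x\<close>, and \<open>P i a\<close> is
  the probability that transmitter \<open>i\<close> sends \<open>a\<close>.
\<close>

definition inputs :: "nat \<Rightarrow> (nat \<Rightarrow> nat) \<Rightarrow> (nat \<Rightarrow> nat) set" where
  "inputs k q = PiE {..<k} (\<lambda>i. {..<q i})"

definition output_dist ::
  "nat \<Rightarrow> (nat \<Rightarrow> nat) \<Rightarrow> (nat \<Rightarrow> nat \<Rightarrow> real) \<Rightarrow> (nat \<Rightarrow> (nat \<Rightarrow> nat) \<Rightarrow> real) \<Rightarrow> nat \<Rightarrow> real" where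
  "output_dist k q P W y = (\<Sum>x\<in>inputs k q. W y x * (\<Prod>j<k. P j (x j)))"

definition marg_channel ::
  "nat \<Rightarrow> (nat \<Rightarrow> nat) \<Rightarrow> (nat \<Rightarrow> nat \<Rightarrow> real) \<Rightarrow> (nat \<Rightarrow> (nat \<Rightarrow> nat) \<Rightarrow> real)
    \<Rightarrow> nat \<Rightarrow> nat \<Rightarrow> nat \<Rightarrow> real" where
  "marg_channel k q P W i y a =
    (\<Sum>x | x \<in> inputs k q \<and> x i = a. W y x * (\<Prod>j\<in>{..<k} - {i}. P j (x j)))"

definition dtm ::
  "nat \<Rightarrow> (nat \<Rightarrow> nat) \<Rightarrow> nat \<Rightarrow> (nat \<Rightarrow> nat \<Rightarrow> real) \<Rightarrow> (nat \<Rightarrow> (nat \<Rightarrow> nat) \<Rightarrow> real)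
    \<Rightarrow> nat \<Rightarrow> real mat" where
  "dtm k q r P W i =
    mat r (q i) (\<lambda>(y, a). marg_channel k q P W i y a * sqrt (P i a) / sqrt (output_dist k q P W y))"

definition kron :: "real mat \<Rightarrow> real mat \<Rightarrow> real mat" where
  "kron A B = mat (dim_row A * dim_row B) (dim_col A * dim_col B)
    (\<lambda>(i, j). A $$ (i div dim_row B, j div dim_col B) * B $$ (i mod dim_row B, j mod dim_col B))"

primrec kron_pow :: "real mat \<Rightarrow> nat \<Rightarrow> real mat" where
  "kron_pow A 0 = 1\<^sub>m 1"
| "kron_pow A (Suc n) = kron A (kron_pow A n)"

definition hconcat :: "nat \<Rightarrow> real mat list \<Rightarrow> real mat" where
  "hconcat m As =
    foldr (\<lambda>A M. four_block_mat A M (0\<^sub>m 0 (dim_col A)) (0\<^sub>m 0 (dim_col M))) As (0\<^sub>m m 0)"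

definition vconcat :: "real vec list \<Rightarrow> real vec" where
  "vconcat vs = foldr (@\<^sub>v) vs (0\<^sub>v 0)"

definition concat_dtm ::
  "nat \<Rightarrow> (nat \<Rightarrow> nat) \<Rightarrow> nat \<Rightarrow> (nat \<Rightarrow> nat \<Rightarrow> real) \<Rightarrow> (nat \<Rightarrow> (nat \<Rightarrow> nat) \<Rightarrow> real)
    \<Rightarrow> nat \<Rightarrow> real mat" where
  "concat_dtm k q r P W n = hconcat (r ^ n) (map (\<lambda>i. kron_pow (dtm k q r P W i) n) [0..<k])"

definition sqrt_dist :: "(nat \<Rightarrow> nat) \<Rightarrow> (nat \<Rightarrow> nat \<Rightarrow> real) \<Rightarrow> nat \<Rightarrow> real vec" where
  "sqrt_dist q P i = vec (q i) (\<lambda>a. sqrt (P i a))"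

text \<open>
  The singular values of \<open>A\<close> in decreasing order, as the square roots of the eigenvalues of
  \<open>A\<^sup>T A\<close> with multiplicity.  As \<open>A\<^sup>T A\<close> is symmetric, its characteristic polynomial splits over
  the reals, so the list has one entry for each column of \<open>A\<close>; a matrix with more columns than
  rows has correspondingly many zeros at the end of the list.
\<close>

definition singular_values :: "real mat \<Rightarrow> real list" where
  "singular_values A =
    rev (sorted_list_of_multiset (image_mset sqrt (proots (char_poly (transpose_mat A * A)))))"

text \<open>A matrix with a single column has second singular value \<open>0\<close>, following the convention that
  singular values beyond the size of the matrix are zero.\<close>

definition second_singular_value :: "real mat \<Rightarrow> real" where
  "second_singular_value A =
    (if 2 \<le> length (singular_values A) then singular_values A ! 1 else 0)"

definition right_singular_vector :: "real mat \<Rightarrow> real vec \<Rightarrow> real \<Rightarrow> bool" where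
  "right_singular_vector A v s \<longleftrightarrow> 0 \<le> s \<and> eigenvector (transpose_mat A * A) v (s\<^sup>2)"

end

theory Submission
  imports Defs "Jordan_Normal_Form.Schur_Decomposition" "Jordan_Normal_Form.Spectral_Radius"
begin

text \<open>
  Write \<open>u\<close> for the vector of the \<open>sqrt (P\<^sub>Y y)\<close> and \<open>v\<^sub>i\<close> for that of the \<open>sqrt (P\<^sub>i a)\<close>.  Each \<open>B\<^sub>i\<^sup>T\<close> is
  a contraction with \<open>B\<^sub>i\<^sup>T u = v\<^sub>i\<close> and \<open>B\<^sub>i v\<^sub>i = u\<close>, so \<open>u\<close> is a top left singular vector of the concatenation
  and its second singular value is the least \<open>s\<close> such that \<open>\<Sum>\<^sub>i |B\<^sub>i\<^sup>T y|\<^sup>2 \<le> s\<^sup>2 |y|\<^sup>2\<close> for all \<open>y\<close> orthogonal to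
  \<open>u\<close>.  Splitting off the \<open>u\<close>-component in one tensor factor, and bounding the other factors by
  contractivity, shows that the same \<open>s\<close> works for the Kronecker powers; vectors \<open>y \<otimes> u \<otimes> \<dots> \<otimes> u\<close>
  show that no smaller one does.  For the orthogonality, a right singular vector \<open>x\<close> with image
  \<open>z\<close> satisfies \<open>s\<^sup>2 (\<psi>\<^sub>i \<bullet> v\<^sub>i) = B\<^sub>i\<^sup>T z \<bullet> v\<^sub>i = z \<bullet> u\<close>, which vanishes as \<open>x\<close> is orthogonal to the top
  right singular vector.
\<close>

section \<open>Diagonalization of real symmetric matrices\<close>

text \<open>Over the complex numbers an eigenvalue \<open>z\<close> exists. Since \<open>S\<close>
  has real entries, conjugating an eigenvector gives one for \<open>cnj z\<close>, and by symmetry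
  the pairing of the two evaluates both to \<open>cnj z\<close> and to \<open>z\<close> times a
  nonzero number, so \<open>z\<close> is real.\<close>

lemma symmetric_real_eigenvalue_exists:
  fixes S :: "real mat"
  assumes S: "S \<in> carrier_mat n n" and sym: "transpose_mat S = S" and n: "n > 0"
  shows "\<exists>e. eigenvalue S e"
proof -
  let ?C = "map_mat complex_of_real S"
  have C: "?C \<in> carrier_mat n n" using S by simp
  obtain z where "eigenvalue ?C z"
    using spectrum_non_empty[OF C] n unfolding spectrum_def by auto
  then obtain w where "eigenvector ?C w z" unfolding eigenvalue_def by auto
  then have w: "w \<in> carrier_vec n" "w \<noteq> 0\<^sub>v n" and Cw: "?C *\<^sub>v w = z \<cdot>\<^sub>v w"
    using S unfolding eigenvector_def by auto
  have "?C *\<^sub>v conjugate w = conjugate (?C *\<^sub>v w)"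
    using S w by (intro eq_vecI) (auto simp: scalar_prod_def conjugate_vec_def)
  then have Ccw: "?C *\<^sub>v conjugate w = cnj z \<cdot>\<^sub>v conjugate w"
    unfolding Cw using w by (auto simp: conjugate_smult_vec)
  have symC: "transpose_mat ?C = ?C"
    by (simp add: map_mat_transpose sym)
  have "cnj z * (conjugate w \<bullet> w) = (?C *\<^sub>v conjugate w) \<bullet> w"
    unfolding Ccw using w by simp
  also have "\<dots> = conjugate w \<bullet> (?C *\<^sub>v w)"
    using transpose_vec_mult_scalar[OF C w(1), of "conjugate w"] w symC by simp
  also have "\<dots> = z * (conjugate w \<bullet> w)"
    unfolding Cw using w by simp
  finally have "cnj z = z"
    using w conjugate_square_eq_0_vec[OF w(1)] comm_scalar_prod[of "conjugate w" n w] by auto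
  then have z: "z = complex_of_real (Re z)" by (simp add: complex_eq_iff)
  \<comment> \<open>The characteristic polynomial of \<open>?C\<close> is that of \<open>S\<close>
    with embedded coefficients, so a root that is real descends to \<open>S\<close>.\<close>
  have "poly (char_poly ?C) z = 0"
    using \<open>eigenvalue ?C z\<close> eigenvalue_root_char_poly[OF C] by simp
  then have "complex_of_real (poly (char_poly S) (Re z)) = 0"
    unfolding of_real_hom.char_poly_hom[OF S] by (subst (asm) z) (simp add: of_real_hom.poly_map_poly)
  then show ?thesis using eigenvalue_root_char_poly[OF S] by auto
qed

text \<open>Gram-Schmidt leaves the first vector of the basis unchanged, so after normalization the
  first column is still a multiple of \<open>v\<close>.\<close>

lemma orthonormal_completion:
  fixes v :: "real vec"
  assumes v: "v \<in> carrier_vec n" and v0: "v \<noteq> 0\<^sub>v n"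
  shows "\<exists>U\<in>carrier_mat n n. transpose_mat U * U = 1\<^sub>m n \<and> (\<exists>c. col U 0 = c \<cdot>\<^sub>v v)"
proof -
  interpret cof_vec_space n "TYPE(real)" .
  define b where "b = basis_completion v"
  define ws where "ws = gram_schmidt n b"
  note bc = basis_completion[OF v v0, folded b_def]
  from v v0 have n: "n > 0" by (cases n) auto
  from bc n obtain vs where bv: "b = v # vs" by (cases b) auto
  note gs = gram_schmidt_result[OF bc(2,4,5) ws_def]
  have hd: "ws ! 0 = v"
    using gram_schmidt_hd[OF v, of vs, folded bv ws_def] gs(4) bc(6) n by (auto simp: hd_conv_nth)
  have len: "length ws = n" using gs(4) bc(6) by simp
  have wc: "ws ! i \<in> carrier_vec n" if "i < n" for i using gs(3) len that by auto
  have orth: "ws ! i \<bullet> ws ! j = 0 \<longleftrightarrow> i \<noteq> j" if "i < n" "j < n" for i j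
    using corthogonalD[OF gs(2)] that len by auto
  define us where "us = map (\<lambda>w. (1 / sqrt (w \<bullet> w)) \<cdot>\<^sub>v w) ws"
  define U where "U = mat_of_cols n us"
  have U: "U \<in> carrier_mat n n" unfolding U_def us_def using len by auto
  have col: "col U i = (1 / sqrt (ws ! i \<bullet> ws ! i)) \<cdot>\<^sub>v ws ! i" if "i < n" for i
    using that len wc[OF that] unfolding U_def us_def by auto
  have "transpose_mat U * U = 1\<^sub>m n"
  proof (rule eq_matI)
    fix i j assume ij: "i < dim_row (1\<^sub>m n :: real mat)" "j < dim_col (1\<^sub>m n :: real mat)"
    then have "(transpose_mat U * U) $$ (i, j) = col U i \<bullet> col U j" using U by simp
    also have "\<dots> = (1\<^sub>m n) $$ (i, j)"
    proof (cases "i = j")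
      case True
      have "ws ! i \<bullet> ws ! i \<noteq> 0" "ws ! i \<bullet> ws ! i \<ge> 0"
        using orth[of i i] ij by (auto simp: scalar_prod_def sum_nonneg)
      then show ?thesis using col[of i] ij wc[of i] True by (simp add: divide_simps)
    next
      case False
      then show ?thesis using col[of i] col[of j] ij wc[of i] wc[of j] orth[of i j] by simp
    qed
    finally show "(transpose_mat U * U) $$ (i, j) = (1\<^sub>m n) $$ (i, j)" .
  qed (use U in auto)
  then show ?thesis using U col[OF n] hd by metis
qed

text \<open>In an orthonormal basis starting along the eigenvector, symmetry clears both the first
  column and the first row off the diagonal, and the remaining block is again symmetric. The smaller
  case is a hypothesis so that the same step serves the induction and, afterwards, a prescribed
  first eigenvector.\<close>

lemma symmetric_deflation:
  fixes S :: "real mat"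
  assumes S: "S \<in> carrier_mat (Suc m) (Suc m)" and sym: "transpose_mat S = S"
    and v: "v \<in> carrier_vec (Suc m)" "v \<noteq> 0\<^sub>v (Suc m)" "S *\<^sub>v v = e \<cdot>\<^sub>v v"
    and IH: "\<And>T :: real mat. T \<in> carrier_mat m m \<Longrightarrow> transpose_mat T = T \<Longrightarrow>
      \<exists>U\<in>carrier_mat m m. transpose_mat U * U = 1\<^sub>m m \<and> diagonal_mat (transpose_mat U * T * U)"
  shows "\<exists>U\<in>carrier_mat (Suc m) (Suc m). transpose_mat U * U = 1\<^sub>m (Suc m)
    \<and> diagonal_mat (transpose_mat U * S * U) \<and> (\<exists>c. col U 0 = c \<cdot>\<^sub>v v)"
proof -
  let ?n = "Suc m"
  obtain W c where W: "W \<in> carrier_mat ?n ?n" and WW: "transpose_mat W * W = 1\<^sub>m ?n"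
    and c: "col W 0 = c \<cdot>\<^sub>v v"
    using orthonormal_completion[OF v(1,2)] by blast
  define T where "T = transpose_mat W * S * W"
  have T: "T \<in> carrier_mat ?n ?n" using W S unfolding T_def by auto
  have symT: "transpose_mat T = T"
    unfolding T_def using W S sym
    by (simp add: transpose_mult[of _ ?n ?n _ ?n] assoc_mult_mat[of _ ?n ?n _ ?n _ ?n])
  have eW: "S *\<^sub>v col W 0 = e \<cdot>\<^sub>v col W 0"
    unfolding c using v S by (simp add: mult_mat_vec smult_smult_assoc ac_simps)
  \<comment> \<open>The first column of \<open>T\<close> is \<open>e\<close> times the first column
    of \<open>transpose_mat W * W\<close>.\<close>
  have T0: "T $$ (i, 0) = (if i = 0 then e else 0)" if i: "i < ?n" for i
  proof -
    have "T $$ (i, 0) = col W i \<bullet> (S *\<^sub>v col W 0)"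
      unfolding T_def using W S i
      by (simp add: assoc_mult_mat[of _ ?n ?n _ ?n _ ?n] mult_mat_vec_def)
    also have "\<dots> = e * (transpose_mat W * W) $$ (i, 0)"
      unfolding eW using W i by simp
    finally show ?thesis unfolding WW using i by simp
  qed
  then have T0': "T $$ (0, i) = (if i = 0 then e else 0)" if i: "i < ?n" for i
    using arg_cong[OF symT, of "\<lambda>M. M $$ (0, i)"] i T by simp
  define R where "R = mat m m (\<lambda>(i, j). T $$ (Suc i, Suc j))"
  have R: "R \<in> carrier_mat m m" unfolding R_def by simp
  have "T $$ (a, b) = T $$ (b, a)" if "a < ?n" "b < ?n" for a b
    using arg_cong[OF symT, of "\<lambda>M. M $$ (a, b)"] that T by simp
  then have "transpose_mat R = R" unfolding R_def by (intro eq_matI) auto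
  from IH[OF R this] obtain V where V: "V \<in> carrier_mat m m" and VV: "transpose_mat V * V = 1\<^sub>m m"
    and dV: "diagonal_mat (transpose_mat V * R * V)" by blast
  have Tb: "T = four_block_mat (mat 1 1 (\<lambda>_. e)) (0\<^sub>m 1 m) (0\<^sub>m m 1) R"
    by (rule eq_matI) (use T T0 T0' in \<open>auto simp: R_def\<close>)
  define F where "F = four_block_mat (1\<^sub>m 1) (0\<^sub>m 1 m) (0\<^sub>m m 1) V"
  have F: "F \<in> carrier_mat ?n ?n" unfolding F_def using V
    by (metis One_nat_def four_block_carrier_mat one_carrier_mat plus_1_eq_Suc)
  have tF: "transpose_mat F = four_block_mat (1\<^sub>m 1) (0\<^sub>m 1 m) (0\<^sub>m m 1) (transpose_mat V)"
    unfolding F_def using V by (subst transpose_four_block_mat[of _ 1 1 _ m _ m]) auto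
  have "transpose_mat F * F = four_block_mat (1\<^sub>m 1) (0\<^sub>m 1 m) (0\<^sub>m m 1) (1\<^sub>m m)"
    unfolding tF unfolding F_def using V VV by (subst mult_four_block_mat[of _ 1 1 _ m _ m _ _ 1 _ m]) auto
  also have "\<dots> = 1\<^sub>m ?n" by (rule eq_matI) auto
  finally have FF: "transpose_mat F * F = 1\<^sub>m ?n" .
  have "transpose_mat F * T * F =
    four_block_mat (mat 1 1 (\<lambda>_. e)) (0\<^sub>m 1 m) (0\<^sub>m m 1) (transpose_mat V * R * V)"
    unfolding tF unfolding F_def Tb using V R
    by (subst mult_four_block_mat[of _ 1 1 _ m _ m _ _ 1 _ m], auto,
        subst mult_four_block_mat[of _ 1 1 _ m _ m _ _ 1 _ m], auto)
  then have dF: "diagonal_mat (transpose_mat F * T * F)"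
    using dV V R unfolding diagonal_mat_def by auto
  let ?U = "W * F"
  have tU: "transpose_mat ?U = transpose_mat F * transpose_mat W"
    using W F by (rule transpose_mult)
  have "transpose_mat ?U * ?U = transpose_mat F * (transpose_mat W * W) * F"
    unfolding tU using W F by (simp add: assoc_mult_mat[of _ ?n ?n _ ?n _ ?n])
  also have "\<dots> = 1\<^sub>m ?n" unfolding WW using F FF by simp
  finally have 1: "transpose_mat ?U * ?U = 1\<^sub>m ?n" .
  have "transpose_mat ?U * S * ?U = transpose_mat F * T * F"
    unfolding tU T_def using W F S by (simp add: assoc_mult_mat[of _ ?n ?n _ ?n _ ?n])
  with dF have 2: "diagonal_mat (transpose_mat ?U * S * ?U)" by simp
  \<comment> \<open>The leading block of \<open>F\<close> is 1, so multiplying by \<open>F\<close>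
    rotates only the other columns of \<open>W\<close> and keeps the direction of \<open>v\<close>
    in front.\<close>
  have "col F 0 = unit_vec ?n 0"
    unfolding F_def using V by (intro eq_vecI) auto
  then have "col ?U 0 = W *\<^sub>v unit_vec ?n 0" using col_mult2[OF W F, of 0] by simp
  also have "\<dots> = col W 0" using W by (intro eq_vecI) auto
  finally have "col ?U 0 = col W 0" .
  then have "col ?U 0 = c \<cdot>\<^sub>v v" using c by simp
  then show ?thesis using 1 2 W F by (meson mult_carrier_mat)
qed

lemma symmetric_diagonalization:
  fixes S :: "real mat"
  assumes "S \<in> carrier_mat n n" "transpose_mat S = S"
  shows "\<exists>U\<in>carrier_mat n n. transpose_mat U * U = 1\<^sub>m n \<and> diagonal_mat (transpose_mat U * S * U)"
  using assms
proof (induction n arbitrary: S)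
  case 0
  then show ?case by (intro bexI[of _ "1\<^sub>m 0"]) (auto simp: diagonal_mat_def)
next
  case (Suc m)
  obtain e v where "eigenvector S v e"
    using symmetric_real_eigenvalue_exists[OF Suc.prems] unfolding eigenvalue_def by auto
  then have "v \<in> carrier_vec (Suc m)" "v \<noteq> 0\<^sub>v (Suc m)" "S *\<^sub>v v = e \<cdot>\<^sub>v v"
    using Suc.prems unfolding eigenvector_def by auto
  from symmetric_deflation[OF Suc.prems this Suc.IH] show ?case by blast
qed

text \<open>Fixing the first column makes it possible to separate a known top direction from all the
  other eigenvalues. One deflation along \<open>v\<close>, with an arbitrary diagonalization of the
  remaining block, suffices.\<close>

lemma symmetric_diagonalization_eigenvector:
  fixes S :: "real mat"
  assumes "S \<in> carrier_mat n n" "transpose_mat S = S"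
    and "v \<in> carrier_vec n" "v \<noteq> 0\<^sub>v n" "S *\<^sub>v v = e \<cdot>\<^sub>v v"
  shows "\<exists>U\<in>carrier_mat n n. transpose_mat U * U = 1\<^sub>m n
    \<and> diagonal_mat (transpose_mat U * S * U) \<and> (\<exists>c. col U 0 = c \<cdot>\<^sub>v v)"
proof (cases n)
  case 0
  then show ?thesis using assms by auto
next
  case (Suc m)
  show ?thesis
    using symmetric_deflation[OF assms[unfolded Suc] symmetric_diagonalization] unfolding Suc .
qed

section \<open>The second singular value as a constrained norm\<close>

lemma sum_Cauchy_Schwarz:
  fixes f g :: "'a \<Rightarrow> real"
  assumes "finite I"
  shows "(\<Sum>i\<in>I. f i * g i)\<^sup>2 \<le> (\<Sum>i\<in>I. (f i)\<^sup>2) * (\<Sum>i\<in>I. (g i)\<^sup>2)"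
proof -
  define a b c where "a = (\<Sum>i\<in>I. (f i)\<^sup>2)" and "b = (\<Sum>i\<in>I. (g i)\<^sup>2)" and "c = (\<Sum>i\<in>I. f i * g i)"
  show ?thesis
  proof (cases "b = 0")
    case True
    then have "g i = 0" if "i \<in> I" for i
      using that assms unfolding b_def by (simp add: sum_nonneg_eq_0_iff)
    then have "c = 0" unfolding c_def by simp
    then show ?thesis using True unfolding a_def b_def c_def by simp
  next
    case False
    then have b: "b > 0" unfolding b_def by (metis less_eq_real_def sum_nonneg zero_le_power2)
    \<comment> \<open>This is the residual of projecting \<open>f\<close> onto \<open>g\<close>,
      multiplied by \<open>b\<close> to avoid a division.\<close>
    have "0 \<le> (\<Sum>i\<in>I. (b * f i - c * g i)\<^sup>2)" by (simp add: sum_nonneg)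
    also have "\<dots> = (\<Sum>i\<in>I. b\<^sup>2 * (f i)\<^sup>2 - 2 * b * c * (f i * g i) + c\<^sup>2 * (g i)\<^sup>2)"
      by (intro sum.cong) (auto simp: power2_eq_square algebra_simps)
    also have "\<dots> = b\<^sup>2 * a - 2 * b * c * c + c\<^sup>2 * b"
      unfolding a_def b_def c_def
      by (simp add: sum.distrib sum_subtractf sum_distrib_left)
    also have "\<dots> = b * (a * b - c\<^sup>2)" by (simp add: power2_eq_square algebra_simps)
    finally show ?thesis using b unfolding a_def b_def c_def by (simp add: zero_le_mult_iff)
  qed
qed

lemma scalar_prod_self_sum: "x \<bullet> x = (\<Sum>i<dim_vec x. (x $ i)\<^sup>2)" for x :: "real vec"
  by (simp add: scalar_prod_def power2_eq_square lessThan_atLeast0)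

lemma scalar_prod_self_nonneg: "0 \<le> x \<bullet> x" for x :: "real vec"
  by (simp add: scalar_prod_self_sum sum_nonneg)

lemma scalar_prod_self_eq_0: "x \<bullet> x = 0 \<longleftrightarrow> x = 0\<^sub>v n" if "x \<in> carrier_vec n" for x :: "real vec"
  using that by (auto simp: scalar_prod_self_sum sum_nonneg_eq_0_iff)

lemma scalar_prod_Cauchy_Schwarz:
  fixes x y :: "real vec"
  assumes "x \<in> carrier_vec n" "y \<in> carrier_vec n"
  shows "(x \<bullet> y)\<^sup>2 \<le> (x \<bullet> x) * (y \<bullet> y)"
  using sum_Cauchy_Schwarz[of "{..<n}" "($) x" "($) y"] assms
  by (simp add: scalar_prod_self_sum) (simp add: scalar_prod_def lessThan_atLeast0)

section \<open>Multisets of roots and sorted lists\<close>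

lemma proots_linear_factors: "proots (\<Prod>a\<leftarrow>as. [:- a, 1:]) = mset (as :: 'a::idom list)"
proof (induction as)
  case (Cons a as)
  have "(\<Prod>a\<leftarrow>as. [:- a, 1:]) \<noteq> 0" by (auto simp: prod_list_zero_iff)
  then have "proots ([:- a, 1:] * (\<Prod>a\<leftarrow>as. [:- a, 1:])) = {#a#} + mset as"
    using Cons by (subst proots_mult) (auto simp del: mult_pCons_left)
  then show ?case by (simp del: mult_pCons_left)
qed simp

lemma rev_sort_Cons_Max:
  assumes "\<And>x. x \<in> set xs \<Longrightarrow> x \<le> m"
  shows "rev (sort (m # xs)) = m # rev (sort xs)"
proof -
  have "sort (m # xs) = sort xs @ [m]"
    using assms by (intro properties_for_sort) (auto simp: sorted_append)
  then show ?thesis by simp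
qed

lemma rev_sort_hd_le_iff:
  fixes s :: "'a::linorder"
  assumes "xs \<noteq> []"
  shows "rev (sort xs) ! 0 \<le> s \<longleftrightarrow> (\<forall>x\<in>set xs. x \<le> s)"
proof -
  have ne: "sort xs \<noteq> []" using assms by (metis set_empty set_sort)
  have "sorted (butlast (sort xs) @ [last (sort xs)])" using ne by simp
  then have "x \<le> last (sort xs)" if "x \<in> set (butlast (sort xs) @ [last (sort xs)])" for x
    using that unfolding sorted_append by auto
  then have "x \<le> last (sort xs)" if "x \<in> set xs" for x
    using that ne by (metis append_butlast_last_id set_sort)
  moreover have "last (sort xs) \<in> set xs" using last_in_set[OF ne] by simp
  moreover have "rev (sort xs) ! 0 = last (sort xs)" using ne by (metis hd_conv_nth hd_rev rev_is_Nil_conv)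
  ultimately show ?thesis by (metis order_trans)
qed

text \<open>A form of the Courant-Fischer principle with known top direction: in an orthonormal
  eigenbasis beginning along \<open>v\<close> the form \<open>|A x|^2\<close> is diagonal, and
  orthogonality to \<open>v\<close> drops exactly its first entry \<open>e\<close>, which is the
  largest. Comparing with every \<open>s\<close> avoids speaking of a supremum.\<close>

lemma second_singular_value_le_iff:
  fixes A :: "real mat"
  assumes A: "A \<in> carrier_mat m n"
    and v: "v \<in> carrier_vec n" "v \<noteq> 0\<^sub>v n" "(transpose_mat A * A) *\<^sub>v v = e \<cdot>\<^sub>v v"
    and top: "\<And>x. x \<in> carrier_vec n \<Longrightarrow> (A *\<^sub>v x) \<bullet> (A *\<^sub>v x) \<le> e * (x \<bullet> x)"
    and s: "0 \<le> s"
  shows "second_singular_value A \<le> s \<longleftrightarrow>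
    (\<forall>x\<in>carrier_vec n. x \<bullet> v = 0 \<longrightarrow> (A *\<^sub>v x) \<bullet> (A *\<^sub>v x) \<le> s\<^sup>2 * (x \<bullet> x))"
proof -
  define S where "S = transpose_mat A * A"
  have S: "S \<in> carrier_mat n n" and symS: "transpose_mat S = S"
    unfolding S_def using A by (auto simp: transpose_mult[of _ n m _ n])
  obtain U c where U: "U \<in> carrier_mat n n" and UU: "transpose_mat U * U = 1\<^sub>m n"
    and dg: "diagonal_mat (transpose_mat U * S * U)" and c: "col U 0 = c \<cdot>\<^sub>v v"
    using symmetric_diagonalization_eigenvector[OF S symS v[folded S_def]] by blast
  define D where "D = transpose_mat U * S * U"
  define d where "d i = D $$ (i, i)" for i
  have D: "D \<in> carrier_mat n n" unfolding D_def using U S by auto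
  have n: "n > 0" using v by (cases n) auto
  have UU': "U * transpose_mat U = 1\<^sub>m n"
    using mat_mult_left_right_inverse[of "transpose_mat U" n U] U UU by simp
  have AS: "(A *\<^sub>v x) \<bullet> (A *\<^sub>v x) = x \<bullet> (S *\<^sub>v x)" if "x \<in> carrier_vec n" for x
    using transpose_vec_mult_scalar[OF A that, of "A *\<^sub>v x"] A that
    by (simp add: S_def assoc_mult_mat_vec[of _ n m _ n] comm_scalar_prod[of _ n])
  have UA: "(A *\<^sub>v (U *\<^sub>v z)) \<bullet> (A *\<^sub>v (U *\<^sub>v z)) = (\<Sum>i<n. d i * (z $ i)\<^sup>2)"
    if z: "z \<in> carrier_vec n" for z
  proof -
    have "(A *\<^sub>v (U *\<^sub>v z)) \<bullet> (A *\<^sub>v (U *\<^sub>v z)) = (S *\<^sub>v (U *\<^sub>v z)) \<bullet> (U *\<^sub>v z)"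
      using AS[of "U *\<^sub>v z"] U S z by (simp add: comm_scalar_prod[of _ n])
    also have "\<dots> = (D *\<^sub>v z) \<bullet> z"
      using transpose_vec_mult_scalar[OF U z, of "S *\<^sub>v (U *\<^sub>v z)"] U S z
      by (simp add: D_def assoc_mult_mat_vec[of _ n n _ n])
    also have "\<dots> = (\<Sum>i<n. d i * (z $ i)\<^sup>2)"
    proof -
      have "(D *\<^sub>v z) $ i = d i * z $ i" if i: "i < n" for i
      proof -
        have "(D *\<^sub>v z) $ i = (\<Sum>j<n. D $$ (i, j) * z $ j)"
          using D z i by (simp add: scalar_prod_def lessThan_atLeast0)
        also have "\<dots> = (\<Sum>j<n. if j = i then d i * z $ i else 0)"
          using dg[folded D_def] D i unfolding diagonal_mat_def d_def
          by (intro sum.cong) auto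
        also have "\<dots> = d i * z $ i" using i by simp
        finally show ?thesis .
      qed
      then show ?thesis
        using z D by (simp add: scalar_prod_def lessThan_atLeast0 power2_eq_square ac_simps)
    qed
    finally show ?thesis .
  qed
  have Uz: "(U *\<^sub>v z) \<bullet> (U *\<^sub>v z) = z \<bullet> z" if z: "z \<in> carrier_vec n" for z
    using transpose_vec_mult_scalar[OF U z, of "U *\<^sub>v z"] U z UU
      assoc_mult_mat_vec[of "transpose_mat U" n n U n z] by simp
  have Uu: "U *\<^sub>v unit_vec n i = col U i" if "i < n" for i
    using U that by (intro eq_vecI) auto
  have dA: "d i = (A *\<^sub>v col U i) \<bullet> (A *\<^sub>v col U i)" if i: "i < n" for i
  proof -
    have "(\<Sum>j<n. d j * (unit_vec n i $ j)\<^sup>2) = (\<Sum>j<n. if j = i then d i else 0)"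
      using i by (intro sum.cong) (auto simp: unit_vec_def)
    then show ?thesis using UA[of "unit_vec n i"] Uu[OF i] i by simp
  qed
  have U1: "col U i \<bullet> col U j = (if i = j then 1 else 0)" if "i < n" "j < n" for i j
    using arg_cong[OF UU, of "\<lambda>M. M $$ (i, j)"] that U by simp
  have cU: "col U i \<in> carrier_vec n" if "i < n" for i using U that by auto
  \<comment> \<open>By \<open>top\<close>, \<open>e\<close> dominates every diagonal entry, so it
    may head the decreasing list even if it is a repeated eigenvalue.\<close>
  have d_le: "d i \<le> e" "0 \<le> d i" if i: "i < n" for i
    using top[OF cU[OF i]] U1[OF i i] dA[OF i] scalar_prod_self_nonneg by auto
  have c0: "c \<noteq> 0"
    using U1[OF n n] c v by auto
  have "S *\<^sub>v col U 0 = e \<cdot>\<^sub>v col U 0"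
    unfolding c using v(1) v(3)[folded S_def] S by (simp add: mult_mat_vec smult_smult_assoc ac_simps)
  then have d0: "d 0 = e"
    using dA[OF n] AS[OF cU[OF n]] U1[OF n n] cU[OF n] by simp
  have perp: "x \<bullet> v = 0 \<longleftrightarrow> x \<bullet> col U 0 = 0" if "x \<in> carrier_vec n" for x
    unfolding c using c0 that v by simp
  have R: "(\<forall>x\<in>carrier_vec n. x \<bullet> v = 0 \<longrightarrow> (A *\<^sub>v x) \<bullet> (A *\<^sub>v x) \<le> s\<^sup>2 * (x \<bullet> x))
    \<longleftrightarrow> (\<forall>i\<in>{1..<n}. d i \<le> s\<^sup>2)" (is "?L \<longleftrightarrow> ?R")
  proof
    assume L: ?L
    show ?R
    proof
      fix i assume "i \<in> {1..<n}"
      then show "d i \<le> s\<^sup>2"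
        using L[rule_format, of "col U i"] perp[of "col U i"] U1[of i 0] U1[of i i] cU[of i] dA[of i] n
        by auto
    qed
  next
    assume R: ?R
    show ?L
    proof (intro ballI impI)
      fix x assume x: "x \<in> carrier_vec n" and "x \<bullet> v = 0"
      then have x0: "x \<bullet> col U 0 = 0" using perp by simp
      \<comment> \<open>The coordinates of \<open>x\<close> in the eigenbasis; orthogonality to
        \<open>v\<close> makes coordinate 0 vanish, the only one whose weight is not bounded by
        \<open>s\<^sup>2\<close>.\<close>
      define z where "z = transpose_mat U *\<^sub>v x"
      have z: "z \<in> carrier_vec n" unfolding z_def using U x by auto
      have xz: "x = U *\<^sub>v z"
        unfolding z_def using U x UU' assoc_mult_mat_vec[of U n n "transpose_mat U" n x] by simp
      have z0: "z $ 0 = 0"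
        unfolding z_def using U x n x0 comm_scalar_prod[of x n "col U 0"] cU[OF n] by simp
      have "(\<Sum>i<n. d i * (z $ i)\<^sup>2) \<le> (\<Sum>i<n. s\<^sup>2 * (z $ i)\<^sup>2)"
      proof (rule sum_mono)
        fix i assume "i \<in> {..<n}"
        then show "d i * (z $ i)\<^sup>2 \<le> s\<^sup>2 * (z $ i)\<^sup>2"
          using R z0 by (cases "i = 0") (auto intro: mult_right_mono)
      qed
      also have "\<dots> = s\<^sup>2 * (x \<bullet> x)"
        using z unfolding xz Uz[OF z] by (simp add: scalar_prod_self_sum sum_distrib_left)
      finally show "(A *\<^sub>v x) \<bullet> (A *\<^sub>v x) \<le> s\<^sup>2 * (x \<bullet> x)"
        using UA[OF z] xz by simp
    qed
  qed
  \<comment> \<open>Similarity turns the roots of the characteristic polynomial, with multiplicity,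
    into the diagonal entries of \<open>D\<close>.\<close>
  have "similar_mat_wit D S (transpose_mat U) U"
    using U UU UU' D S by (intro similar_mat_witI) (auto simp: D_def)
  then have "char_poly S = char_poly D" using char_poly_similar unfolding similar_mat_def by metis
  also have "\<dots> = (\<Prod>a\<leftarrow>diag_mat D. [:- a, 1:])"
    using dg[folded D_def] D by (intro char_poly_upper_triangular[OF D]) (auto simp: diagonal_mat_def)
  finally have "proots (char_poly S) = mset (diag_mat D)"
    using proots_linear_factors by simp
  moreover have "diag_mat D = map d [0..<n]"
    unfolding diag_mat_def d_def using D by simp
  moreover have "[0..<n] = 0 # [1..<n]" using n by (simp add: upt_conv_Cons)
  ultimately have "proots (char_poly S) = mset (e # map d [1..<n])" using d0 by simp
  then have "singular_values A = rev (sort (sqrt e # map (sqrt \<circ> d) [1..<n]))"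
    unfolding singular_values_def S_def[symmetric]
    by (metis list.map(2) map_map mset_map sorted_list_of_multiset_mset)
  also have "\<dots> = sqrt e # rev (sort (map (sqrt \<circ> d) [1..<n]))"
    using d_le by (intro rev_sort_Cons_Max) auto
  finally have sv: "singular_values A = sqrt e # rev (sort (map (sqrt \<circ> d) [1..<n]))" .
  have sq: "sqrt (d i) \<le> s \<longleftrightarrow> d i \<le> s\<^sup>2" if "i < n" for i
    using s by (metis real_sqrt_le_iff real_sqrt_unique)
  have "second_singular_value A \<le> s \<longleftrightarrow> (\<forall>i\<in>{1..<n}. d i \<le> s\<^sup>2)"
  proof (cases "n = 1")
    \<comment> \<open>With a single column the second singular value is 0 by convention, and no
      index remains on the right: both sides hold.\<close>
    case True
    then show ?thesis using sv s by (simp add: second_singular_value_def)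
  next
    case False
    then have "second_singular_value A = rev (sort (map (sqrt \<circ> d) [1..<n])) ! 0"
      using n by (simp add: second_singular_value_def sv)
    then show ?thesis
      using rev_sort_hd_le_iff[of "map (sqrt \<circ> d) [1..<n]" s] False n sq by auto
  qed
  then show ?thesis using R by simp
qed

text \<open>\<open>|A x|^2\<close> is the product of \<open>A^T A x\<close> with \<open>x\<close>,
  so Cauchy-Schwarz applies and one factor \<open>|A x|\<close> cancels. The bound on the transpose
  is assumed only at the single vector \<open>A x\<close>, which allows bounds on a subspace to be
  transferred too.\<close>

lemma gram_bound_transfer:
  fixes A :: "real mat"
  assumes A: "A \<in> carrier_mat m n" and x: "x \<in> carrier_vec n" and t: "0 \<le> t"
    and b: "(transpose_mat A *\<^sub>v (A *\<^sub>v x)) \<bullet> (transpose_mat A *\<^sub>v (A *\<^sub>v x)) \<le> t * ((A *\<^sub>v x) \<bullet> (A *\<^sub>v x))"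
  shows "(A *\<^sub>v x) \<bullet> (A *\<^sub>v x) \<le> t * (x \<bullet> x)"
proof -
  let ?N = "(A *\<^sub>v x) \<bullet> (A *\<^sub>v x)" and ?z = "transpose_mat A *\<^sub>v (A *\<^sub>v x)"
  have z: "?z \<in> carrier_vec n" using A x by (intro mult_mat_vec_carrier[of _ n m]) auto
  have "?N = ?z \<bullet> x"
    using transpose_vec_mult_scalar[OF A x mult_mat_vec_carrier[OF A x]] by simp
  then have "?N\<^sup>2 \<le> (?z \<bullet> ?z) * (x \<bullet> x)" using scalar_prod_Cauchy_Schwarz[OF z x] by simp
  also have "\<dots> \<le> t * ?N * (x \<bullet> x)" using b scalar_prod_self_nonneg by (intro mult_right_mono) auto
  finally have *: "?N * ?N \<le> ?N * (t * (x \<bullet> x))" by (simp add: power2_eq_square ac_simps)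
  show ?thesis
  proof (cases "?N = 0")
    case True
    then show ?thesis using t scalar_prod_self_nonneg[of x] by simp
  next
    case False
    then have "?N > 0" using scalar_prod_self_nonneg[of "A *\<^sub>v x"] by simp
    then show ?thesis using * by simp
  qed
qed

text \<open>\<open>A\<close> maps the complement of \<open>v\<close> into that of \<open>u\<close>,
  and its transpose maps back, so \<open>gram_bound_transfer\<close> carries the constrained bound
  both ways. Left vectors are preferable for a concatenation: they live in the output space shared
  by all blocks.\<close>

lemma second_singular_value_le_iff_transpose:
  fixes A :: "real mat"
  assumes A: "A \<in> carrier_mat m n"
    and v: "v \<in> carrier_vec n" and u: "u \<in> carrier_vec m" and u1: "u \<bullet> u = 1" and e: "0 < e"
    and Av: "A *\<^sub>v v = e \<cdot>\<^sub>v u" and Au: "transpose_mat A *\<^sub>v u = v"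
    and top: "\<And>y. y \<in> carrier_vec m \<Longrightarrow>
      (transpose_mat A *\<^sub>v y) \<bullet> (transpose_mat A *\<^sub>v y) \<le> e * (y \<bullet> y)"
    and s: "0 \<le> s"
  shows "second_singular_value A \<le> s \<longleftrightarrow> (\<forall>y\<in>carrier_vec m. y \<bullet> u = 0 \<longrightarrow>
    (transpose_mat A *\<^sub>v y) \<bullet> (transpose_mat A *\<^sub>v y) \<le> s\<^sup>2 * (y \<bullet> y))" (is "?lhs \<longleftrightarrow> ?rhs")
proof -
  have tA: "transpose_mat A \<in> carrier_mat n m" using A by simp
  have "v \<bullet> v = e" using transpose_vec_mult_scalar[OF A v u] Au Av u u1 by simp
  then have v0: "v \<noteq> 0\<^sub>v n" using e by auto
  have Sv: "(transpose_mat A * A) *\<^sub>v v = e \<cdot>\<^sub>v v"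
    using A v u Av Au by (simp add: assoc_mult_mat_vec[of _ n m _ n] mult_mat_vec)
  have topx: "(A *\<^sub>v x) \<bullet> (A *\<^sub>v x) \<le> e * (x \<bullet> x)" if "x \<in> carrier_vec n" for x
    using gram_bound_transfer[OF A that _ top] e A that by auto
  have xv: "(A *\<^sub>v x) \<bullet> u = x \<bullet> v" if x: "x \<in> carrier_vec n" for x
    using transpose_vec_mult_scalar[OF A x u] Au A u v x 
      comm_scalar_prod[OF x v] comm_scalar_prod[OF u, of "A *\<^sub>v x"] by simp
  have yu: "(transpose_mat A *\<^sub>v y) \<bullet> v = e * (y \<bullet> u)" if y: "y \<in> carrier_vec m" for y
    using transpose_vec_mult_scalar[OF A v y] Av u y by simp
  have "?lhs \<longleftrightarrow> (\<forall>x\<in>carrier_vec n. x \<bullet> v = 0 \<longrightarrow> (A *\<^sub>v x) \<bullet> (A *\<^sub>v x) \<le> s\<^sup>2 * (x \<bullet> x))"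
    by (rule second_singular_value_le_iff[OF A v v0 Sv topx s])
  also have "\<dots> \<longleftrightarrow> ?rhs"
  proof (intro iffI ballI impI)
    fix y assume L: "\<forall>x\<in>carrier_vec n. x \<bullet> v = 0 \<longrightarrow> (A *\<^sub>v x) \<bullet> (A *\<^sub>v x) \<le> s\<^sup>2 * (x \<bullet> x)"
      and y: "y \<in> carrier_vec m" "y \<bullet> u = 0"
    have "transpose_mat A *\<^sub>v y \<in> carrier_vec n" using tA y(1) by (rule mult_mat_vec_carrier)
    then show "(transpose_mat A *\<^sub>v y) \<bullet> (transpose_mat A *\<^sub>v y) \<le> s\<^sup>2 * (y \<bullet> y)"
      using L yu[OF y(1)] y gram_bound_transfer[OF tA y(1), of "s\<^sup>2"] by simp
  next
    fix x assume R: ?rhs and x: "x \<in> carrier_vec n" "x \<bullet> v = 0"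
    have "A *\<^sub>v x \<in> carrier_vec m" using A x(1) by (rule mult_mat_vec_carrier)
    then show "(A *\<^sub>v x) \<bullet> (A *\<^sub>v x) \<le> s\<^sup>2 * (x \<bullet> x)"
      using R xv[OF x(1)] x gram_bound_transfer[OF A x(1), of "s\<^sup>2"] by simp
  qed
  finally show ?thesis .
qed

section \<open>Kronecker products\<close>

lemma sum_lessThan_mult:
  fixes f :: "nat \<Rightarrow> 'a::comm_monoid_add"
  shows "(\<Sum>i<m * n. f i) = (\<Sum>a<m. \<Sum>b<n. f (a * n + b))"
proof -
  have "(\<Sum>i<m * n. f i) = (\<Sum>a<m. sum f {a * n..<a * n + n})" by (simp add: sum.nat_group)
  also have "\<dots> = (\<Sum>a<m. \<Sum>b<n. f (a * n + b))"
  proof (rule sum.cong[OF refl])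
    fix a
    show "sum f {a * n..<a * n + n} = (\<Sum>b<n. f (a * n + b))"
      using sum.shift_bounds_nat_ivl[of f 0 "a * n" n] by (simp add: lessThan_atLeast0 add.commute)
  qed
  finally show ?thesis .
qed

lemma less_mult_pair: "a < m \<Longrightarrow> b < n \<Longrightarrow> a * n + b < m * n" for a b m n :: nat
  by (metis add_less_mono1 add.commute less_le_trans mult_Suc mult_le_mono1 Suc_leI nat_add_left_cancel_less)

text \<open>Pythagoras for arrays: each column of \<open>w\<close> is orthogonal to the unit vector
  \<open>v\<close>, so the cross terms with the rank-one array cancel.\<close>

lemma sum_rank_one_plus_orthogonal:
  fixes v h :: "nat \<Rightarrow> real"
  assumes v: "(\<Sum>c\<in>I. (v c)\<^sup>2) = 1" and w: "\<And>d. d \<in> J \<Longrightarrow> (\<Sum>c\<in>I. v c * w c d) = 0"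
  shows "(\<Sum>c\<in>I. \<Sum>d\<in>J. (v c * h d + w c d)\<^sup>2)
    = (\<Sum>d\<in>J. (h d)\<^sup>2) + (\<Sum>c\<in>I. \<Sum>d\<in>J. (w c d)\<^sup>2)"
proof -
  have "(\<Sum>c\<in>I. \<Sum>d\<in>J. (v c * h d + w c d)\<^sup>2)
    = (\<Sum>c\<in>I. \<Sum>d\<in>J. (v c)\<^sup>2 * (h d)\<^sup>2) + (\<Sum>c\<in>I. \<Sum>d\<in>J. 2 * h d * (v c * w c d))
      + (\<Sum>c\<in>I. \<Sum>d\<in>J. (w c d)\<^sup>2)"
    by (simp add: power2_sum power_mult_distrib sum.distrib algebra_simps)
  also have "(\<Sum>c\<in>I. \<Sum>d\<in>J. (v c)\<^sup>2 * (h d)\<^sup>2) = (\<Sum>d\<in>J. (h d)\<^sup>2)"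
    by (simp add: sum_product[symmetric] v)
  also have "(\<Sum>c\<in>I. \<Sum>d\<in>J. 2 * h d * (v c * w c d)) = (\<Sum>d\<in>J. 2 * h d * (\<Sum>c\<in>I. v c * w c d))"
    by (subst sum.swap) (simp add: sum_distrib_left)
  also have "\<dots> = 0" using w by simp
  finally show ?thesis by simp
qed

lemma kron_sum_swap:
  fixes M C Y :: "nat \<Rightarrow> nat \<Rightarrow> real"
  shows "(\<Sum>a\<in>A. \<Sum>b\<in>B. M c a * C d b * Y a b) = (\<Sum>b\<in>B. C d b * (\<Sum>a\<in>A. M c a * Y a b))"
proof -
  have "(\<Sum>a\<in>A. \<Sum>b\<in>B. M c a * C d b * Y a b) = (\<Sum>b\<in>B. \<Sum>a\<in>A. M c a * C d b * Y a b)"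
    by (rule sum.swap)
  also have "\<dots> = (\<Sum>b\<in>B. C d b * (\<Sum>a\<in>A. M c a * Y a b))"
    unfolding sum_distrib_left by (intro sum.cong refl) simp
  finally show ?thesis .
qed

text \<open>The two factors act on different indices, so \<open>M\<close> can be applied first; then
  \<open>C\<close> acts separately for each \<open>c\<close> and cannot increase the norm.\<close>

lemma kron_sum_right_contraction:
  fixes M C Y :: "nat \<Rightarrow> nat \<Rightarrow> real"
  assumes "\<And>g. (\<Sum>d\<in>T. (\<Sum>b\<in>B. C d b * g b)\<^sup>2) \<le> (\<Sum>b\<in>B. (g b)\<^sup>2)"
  shows "(\<Sum>c\<in>R. \<Sum>d\<in>T. (\<Sum>a\<in>A. \<Sum>b\<in>B. M c a * C d b * Y a b)\<^sup>2)
    \<le> (\<Sum>b\<in>B. \<Sum>c\<in>R. (\<Sum>a\<in>A. M c a * Y a b)\<^sup>2)"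
proof -
  have "(\<Sum>c\<in>R. \<Sum>d\<in>T. (\<Sum>a\<in>A. \<Sum>b\<in>B. M c a * C d b * Y a b)\<^sup>2)
    \<le> (\<Sum>c\<in>R. \<Sum>b\<in>B. (\<Sum>a\<in>A. M c a * Y a b)\<^sup>2)"
    unfolding kron_sum_swap by (intro sum_mono assms)
  also have "\<dots> = (\<Sum>b\<in>B. \<Sum>c\<in>R. (\<Sum>a\<in>A. M c a * Y a b)\<^sup>2)" by (rule sum.swap)
  finally show ?thesis .
qed

text \<open>Splitting \<open>Y = u \<otimes> g + Z\<close> with the columns of \<open>Z\<close> orthogonal to \<open>u\<close>, the image of the first
  part is \<open>v \<otimes> C g\<close> and stays orthogonal to that of the second; the bound for \<open>C\<close> handles the
  first part, and the bound for \<open>M\<close> together with the contractivity of \<open>C\<close> the second.\<close>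

lemma kron_sum_bound:
  fixes M C :: "nat \<Rightarrow> nat \<Rightarrow> nat \<Rightarrow> real" and Y :: "nat \<Rightarrow> nat \<Rightarrow> real"
  assumes u: "(\<Sum>a\<in>A. (u a)\<^sup>2) = 1" and v: "\<And>i. i \<in> I \<Longrightarrow> (\<Sum>c\<in>R i. (v i c)\<^sup>2) = 1"
    and Mu: "\<And>i c. i \<in> I \<Longrightarrow> c \<in> R i \<Longrightarrow> (\<Sum>a\<in>A. M i c a * u a) = v i c"
    and Mv: "\<And>i a. i \<in> I \<Longrightarrow> a \<in> A \<Longrightarrow> (\<Sum>c\<in>R i. M i c a * v i c) = u a"
    and C: "\<And>i g. i \<in> I \<Longrightarrow> (\<Sum>d\<in>T i. (\<Sum>b\<in>B. C i d b * g b)\<^sup>2) \<le> (\<Sum>b\<in>B. (g b)\<^sup>2)"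
    and bM: "\<And>f. (\<Sum>a\<in>A. f a * u a) = 0 \<Longrightarrow>
      (\<Sum>i\<in>I. \<Sum>c\<in>R i. (\<Sum>a\<in>A. M i c a * f a)\<^sup>2) \<le> t * (\<Sum>a\<in>A. (f a)\<^sup>2)"
    and bC: "\<And>g. (\<Sum>b\<in>B. g b * w b) = 0 \<Longrightarrow>
      (\<Sum>i\<in>I. \<Sum>d\<in>T i. (\<Sum>b\<in>B. C i d b * g b)\<^sup>2) \<le> t * (\<Sum>b\<in>B. (g b)\<^sup>2)"
    and perp: "(\<Sum>a\<in>A. \<Sum>b\<in>B. Y a b * (u a * w b)) = 0"
  shows "(\<Sum>i\<in>I. \<Sum>c\<in>R i. \<Sum>d\<in>T i. (\<Sum>a\<in>A. \<Sum>b\<in>B. M i c a * C i d b * Y a b)\<^sup>2)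
    \<le> t * (\<Sum>a\<in>A. \<Sum>b\<in>B. (Y a b)\<^sup>2)"
proof -
  define g where "g b = (\<Sum>a\<in>A. u a * Y a b)" for b
  define Z where "Z a b = Y a b - u a * g b" for a b
  have Y: "Y a b = u a * g b + Z a b" for a b by (simp add: Z_def)
  have uZ: "(\<Sum>a\<in>A. u a * Z a b) = 0" for b
  proof -
    have "(\<Sum>a\<in>A. u a * Z a b) = g b - (\<Sum>a\<in>A. (u a)\<^sup>2) * g b"
      by (simp add: Z_def g_def[of b, symmetric] right_diff_distrib sum_subtractf sum_distrib_right
          power2_eq_square mult.assoc)
    then show ?thesis using u by simp
  qed
  have NY: "(\<Sum>a\<in>A. \<Sum>b\<in>B. (Y a b)\<^sup>2) = (\<Sum>b\<in>B. (g b)\<^sup>2) + (\<Sum>b\<in>B. \<Sum>a\<in>A. (Z a b)\<^sup>2)"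
    unfolding Y by (subst sum_rank_one_plus_orthogonal[OF u uZ]) (subst sum.swap, rule refl)
  have split: "(\<Sum>c\<in>R i. \<Sum>d\<in>T i. (\<Sum>a\<in>A. \<Sum>b\<in>B. M i c a * C i d b * Y a b)\<^sup>2)
      = (\<Sum>d\<in>T i. (\<Sum>b\<in>B. C i d b * g b)\<^sup>2)
        + (\<Sum>c\<in>R i. \<Sum>d\<in>T i. (\<Sum>a\<in>A. \<Sum>b\<in>B. M i c a * C i d b * Z a b)\<^sup>2)"
    if i: "i \<in> I" for i
  proof -
    let ?h = "\<lambda>d. \<Sum>b\<in>B. C i d b * g b" and ?w = "\<lambda>c d. \<Sum>a\<in>A. \<Sum>b\<in>B. M i c a * C i d b * Z a b"
    have "(\<Sum>a\<in>A. \<Sum>b\<in>B. M i c a * C i d b * Y a b) = v i c * ?h d + ?w c d"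
      if "c \<in> R i" for c d
      unfolding Y Mu[OF i that, symmetric] sum_product sum.distrib[symmetric]
      by (intro sum.cong refl) (simp add: algebra_simps)
    \<comment> \<open>Pairing with \<open>v i\<close> amounts to applying the transpose of
      \<open>M i\<close> to \<open>v i\<close>, which returns \<open>u\<close> by \<open>Mv\<close>,
      and \<open>u\<close> annihilates every column of \<open>Z\<close>.\<close>
    moreover have "(\<Sum>c\<in>R i. v i c * ?w c d) = 0" for d
    proof -
      have "(\<Sum>c\<in>R i. v i c * ?w c d) = (\<Sum>c\<in>R i. \<Sum>b\<in>B. C i d b * (v i c * (\<Sum>a\<in>A. M i c a * Z a b)))"
        unfolding kron_sum_swap by (simp add: sum_distrib_left ac_simps)
      also have "\<dots> = (\<Sum>b\<in>B. C i d b * (\<Sum>c\<in>R i. v i c * (\<Sum>a\<in>A. M i c a * Z a b)))"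
        by (subst sum.swap) (simp add: sum_distrib_left)
      also have "\<dots> = 0"
      proof (intro sum.neutral ballI)
        fix b
        have "(\<Sum>c\<in>R i. v i c * (\<Sum>a\<in>A. M i c a * Z a b)) = (\<Sum>a\<in>A. (\<Sum>c\<in>R i. M i c a * v i c) * Z a b)"
          by (simp add: sum_distrib_left sum_distrib_right, subst sum.swap) (simp add: ac_simps)
        also have "\<dots> = (\<Sum>a\<in>A. u a * Z a b)" using Mv[OF i] by simp
        finally show "C i d b * (\<Sum>c\<in>R i. v i c * (\<Sum>a\<in>A. M i c a * Z a b)) = 0" using uZ by simp
      qed
      finally show ?thesis .
    qed
    ultimately show ?thesis by (simp add: sum_rank_one_plus_orthogonal[OF v[OF i]])
  qed
  \<comment> \<open>Orthogonality of \<open>Y\<close> to the product of \<open>u\<close> and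
    \<open>w\<close> is orthogonality of the coefficient vector \<open>g\<close> to
    \<open>w\<close>, which makes \<open>bC\<close> applicable.\<close>
  have "(\<Sum>b\<in>B. g b * w b) = (\<Sum>b\<in>B. \<Sum>a\<in>A. Y a b * (u a * w b))"
    unfolding g_def sum_distrib_right by (intro sum.cong refl) simp
  also have "\<dots> = 0" using perp by (subst sum.swap)
  finally have "(\<Sum>b\<in>B. g b * w b) = 0" .
  then have 1: "(\<Sum>i\<in>I. \<Sum>d\<in>T i. (\<Sum>b\<in>B. C i d b * g b)\<^sup>2) \<le> t * (\<Sum>b\<in>B. (g b)\<^sup>2)" by (rule bC)
  have "(\<Sum>i\<in>I. \<Sum>c\<in>R i. \<Sum>d\<in>T i. (\<Sum>a\<in>A. \<Sum>b\<in>B. M i c a * C i d b * Z a b)\<^sup>2)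
      \<le> (\<Sum>i\<in>I. \<Sum>b\<in>B. \<Sum>c\<in>R i. (\<Sum>a\<in>A. M i c a * Z a b)\<^sup>2)"
    by (intro sum_mono kron_sum_right_contraction C)
  \<comment> \<open>The sum over \<open>i\<close> has to move inside, because \<open>bM\<close>
    bounds only the total over all \<open>i\<close>, one column of \<open>Z\<close> at a
    time.\<close>
  also have "\<dots> = (\<Sum>b\<in>B. \<Sum>i\<in>I. \<Sum>c\<in>R i. (\<Sum>a\<in>A. M i c a * Z a b)\<^sup>2)" by (rule sum.swap)
  also have "\<dots> \<le> (\<Sum>b\<in>B. t * (\<Sum>a\<in>A. (Z a b)\<^sup>2))"
    using uZ by (intro sum_mono bM) (simp add: mult.commute)
  finally have 2: "(\<Sum>i\<in>I. \<Sum>c\<in>R i. \<Sum>d\<in>T i. (\<Sum>a\<in>A. \<Sum>b\<in>B. M i c a * C i d b * Z a b)\<^sup>2)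
      \<le> t * (\<Sum>b\<in>B. \<Sum>a\<in>A. (Z a b)\<^sup>2)" by (simp add: sum_distrib_left)
  have "(\<Sum>i\<in>I. \<Sum>c\<in>R i. \<Sum>d\<in>T i. (\<Sum>a\<in>A. \<Sum>b\<in>B. M i c a * C i d b * Y a b)\<^sup>2)
      = (\<Sum>i\<in>I. \<Sum>d\<in>T i. (\<Sum>b\<in>B. C i d b * g b)\<^sup>2)
        + (\<Sum>i\<in>I. \<Sum>c\<in>R i. \<Sum>d\<in>T i. (\<Sum>a\<in>A. \<Sum>b\<in>B. M i c a * C i d b * Z a b)\<^sup>2)"
    by (simp add: split sum.distrib)
  also have "\<dots> \<le> t * (\<Sum>a\<in>A. \<Sum>b\<in>B. (Y a b)\<^sup>2)"
    unfolding NY using 1 2 by (simp add: distrib_left)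
  finally show ?thesis .
qed

section \<open>Kronecker products and powers of matrices and vectors\<close>

lemma dim_kron [simp]: "dim_row (kron A B) = dim_row A * dim_row B" "dim_col (kron A B) = dim_col A * dim_col B"
  by (simp_all add: kron_def)

lemma kron_carrier: "A \<in> carrier_mat m n \<Longrightarrow> B \<in> carrier_mat k l \<Longrightarrow> kron A B \<in> carrier_mat (m * k) (n * l)"
  by (intro carrier_matI) auto

lemma transpose_kron: "transpose_mat (kron A B) = kron (transpose_mat A) (transpose_mat B)"
proof (rule eq_matI)
  fix i j assume "i < dim_row (kron (transpose_mat A) (transpose_mat B))"
    "j < dim_col (kron (transpose_mat A) (transpose_mat B))"
  then have ij: "i < dim_col A * dim_col B" "j < dim_row A * dim_row B" by simp_all
  then have "dim_col B > 0" "dim_row B > 0" by (auto intro: gr0I)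
  then show "transpose_mat (kron A B) $$ (i, j) = kron (transpose_mat A) (transpose_mat B) $$ (i, j)"
    using ij by (simp add: kron_def less_mult_imp_div_less)
qed simp_all

lemma transpose_kron_pow: "transpose_mat (kron_pow A n) = kron_pow (transpose_mat A) n"
  by (induction n) (simp_all add: transpose_kron)

lemma kron_pow_1: "kron_pow A 1 = A"
  by (rule eq_matI) (auto simp: kron_def)

lemma kron_mult_vec_index:
  assumes A: "A \<in> carrier_mat m n" and B: "B \<in> carrier_mat k l" and y: "y \<in> carrier_vec (n * l)"
    and c: "c < m" and d: "d < k"
  shows "(kron A B *\<^sub>v y) $ (c * k + d) = (\<Sum>a<n. \<Sum>b<l. A $$ (c, a) * B $$ (d, b) * y $ (a * l + b))"
proof -
  have "(kron A B *\<^sub>v y) $ (c * k + d) = (\<Sum>j<n * l. kron A B $$ (c * k + d, j) * y $ j)"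
    using A B y less_mult_pair[OF c d] by (simp add: scalar_prod_def lessThan_atLeast0)
  also have "\<dots> = (\<Sum>a<n. \<Sum>b<l. A $$ (c, a) * B $$ (d, b) * y $ (a * l + b))"
    unfolding sum_lessThan_mult
    using A B less_mult_pair[OF c d] d less_mult_pair by (intro sum.cong) (auto simp: kron_def)
  finally show ?thesis .
qed

text \<open>The one-column case of \<open>kron\<close>, with the same index convention, kept as a
  vector so that matrices can be applied to it directly.\<close>

definition kron_vec :: "real vec \<Rightarrow> real vec \<Rightarrow> real vec" where
  "kron_vec x w = vec (dim_vec x * dim_vec w) (\<lambda>i. x $ (i div dim_vec w) * w $ (i mod dim_vec w))"

primrec kron_vec_pow :: "real vec \<Rightarrow> nat \<Rightarrow> real vec" where
  "kron_vec_pow x 0 = vec 1 (\<lambda>_. 1)"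
| "kron_vec_pow x (Suc n) = kron_vec x (kron_vec_pow x n)"

lemma kron_vec_carrier: "x \<in> carrier_vec m \<Longrightarrow> w \<in> carrier_vec n \<Longrightarrow> kron_vec x w \<in> carrier_vec (m * n)"
  by (intro carrier_vecI) (auto simp: kron_vec_def)

lemma kron_vec_index:
  assumes "x \<in> carrier_vec m" "w \<in> carrier_vec n" "a < m" "b < n"
  shows "kron_vec x w $ (a * n + b) = x $ a * w $ b"
proof -
  have "(a * n + b) div n = a" "(a * n + b) mod n = b" using assms(4) by simp_all
  then show ?thesis using assms less_mult_pair[OF assms(3,4)] by (simp add: kron_vec_def)
qed

lemma kron_vec_pow_carrier: "x \<in> carrier_vec m \<Longrightarrow> kron_vec_pow x n \<in> carrier_vec (m ^ n)"
  by (induction n) (auto intro: kron_vec_carrier)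

lemma vec_eq_pairI:
  assumes "x \<in> carrier_vec (m * n)" "y \<in> carrier_vec (m * n)"
    and "\<And>a b. a < m \<Longrightarrow> b < n \<Longrightarrow> x $ (a * n + b) = y $ (a * n + b)"
  shows "x = y"
proof (rule eq_vecI)
  fix i assume "i < dim_vec y"
  then have i: "i < m * n" using assms by simp
  then have "n > 0" by (auto intro: gr0I)
  then show "x $ i = y $ i"
    using assms(3)[of "i div n" "i mod n"] i by (simp add: less_mult_imp_div_less)
qed (use assms in auto)

text \<open>The mixed-product rule: the double sum in each entry factors into two single
  sums.\<close>

lemma kron_mult_kron_vec:
  assumes A: "A \<in> carrier_mat m n" and B: "B \<in> carrier_mat k l"
    and x: "x \<in> carrier_vec n" and w: "w \<in> carrier_vec l"
  shows "kron A B *\<^sub>v kron_vec x w = kron_vec (A *\<^sub>v x) (B *\<^sub>v w)"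
proof (rule vec_eq_pairI[of _ m k])
  fix a b assume ab: "a < m" "b < k"
  have Ax: "A *\<^sub>v x \<in> carrier_vec m" "B *\<^sub>v w \<in> carrier_vec k" using A B x w by auto
  show "(kron A B *\<^sub>v kron_vec x w) $ (a * k + b) = kron_vec (A *\<^sub>v x) (B *\<^sub>v w) $ (a * k + b)"
    unfolding kron_mult_vec_index[OF A B kron_vec_carrier[OF x w] ab] kron_vec_index[OF Ax ab]
    using A B x w ab
    by (simp add: scalar_prod_def sum_product lessThan_atLeast0[symmetric])
      (intro sum.cong refl, simp add: kron_vec_index[OF x w])
qed (use kron_carrier[OF A B] kron_vec_carrier[OF x w] A B x w in
    \<open>auto intro!: mult_mat_vec_carrier kron_vec_carrier\<close>)

lemma kron_vec_scalar_prod: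
  assumes "x \<in> carrier_vec m" "x' \<in> carrier_vec m" "w \<in> carrier_vec n" "w' \<in> carrier_vec n"
  shows "kron_vec x w \<bullet> kron_vec x' w' = (x \<bullet> x') * (w \<bullet> w')"
proof -
  have "kron_vec x w \<bullet> kron_vec x' w' = (\<Sum>i<m * n. kron_vec x w $ i * kron_vec x' w' $ i)"
    using kron_vec_carrier[OF assms(2,4)] by (simp add: scalar_prod_def lessThan_atLeast0)
  also have "\<dots> = (\<Sum>a<m. \<Sum>b<n. (x $ a * x' $ a) * (w $ b * w' $ b))"
    unfolding sum_lessThan_mult
    by (intro sum.cong refl) (use kron_vec_index[OF assms(1,3)] kron_vec_index[OF assms(2,4)] in auto)
  also have "\<dots> = (x \<bullet> x') * (w \<bullet> w')"
    using assms by (simp add: scalar_prod_def lessThan_atLeast0 sum_product)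
  finally show ?thesis .
qed

section \<open>Concatenations of Kronecker powers\<close>

text \<open>An eigenvector \<open>x\<close> of the Gram matrix with eigenvalue \<open>e\<close>
  satisfies \<open>e * (x \<bullet> x) = |A x|^2\<close>. Nonnegativity is what lets comparisons
  with all \<open>s \<ge> 0\<close> determine the second singular value.\<close>

lemma second_singular_value_nonneg: "0 \<le> second_singular_value A"
proof -
  let ?S = "transpose_mat A * A" and ?n = "dim_col A"
  have A: "A \<in> carrier_mat (dim_row A) ?n" by simp
  have S: "?S \<in> carrier_mat ?n ?n" by (intro carrier_matI) auto
  have "0 \<le> e" if "e \<in># proots (char_poly ?S)" for e
  proof -
    have "char_poly ?S \<noteq> 0" using degree_monic_char_poly[OF S] by auto
    then have "eigenvalue ?S e" using that eigenvalue_root_char_poly[OF S] by simp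
    then obtain x where x: "x \<in> carrier_vec ?n" "x \<noteq> 0\<^sub>v ?n" and ev: "?S *\<^sub>v x = e \<cdot>\<^sub>v x"
      unfolding eigenvalue_def eigenvector_def by auto
    have "(A *\<^sub>v x) \<bullet> (A *\<^sub>v x) = (?S *\<^sub>v x) \<bullet> x"
      using transpose_vec_mult_scalar[OF A x(1) mult_mat_vec_carrier[OF A x(1)]] x(1)
      by (simp add: assoc_mult_mat_vec[of _ ?n "dim_row A" _ ?n])
    then have "0 \<le> e * (x \<bullet> x)"
      using ev x scalar_prod_self_nonneg[of "A *\<^sub>v x"] by simp
    moreover have "0 < x \<bullet> x"
      using scalar_prod_self_eq_0[OF x(1)] x(2) scalar_prod_self_nonneg[of x] by simp
    ultimately show ?thesis by (simp add: zero_le_mult_iff)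
  qed
  then have "\<forall>s\<in>set (singular_values A). 0 \<le> s" unfolding singular_values_def by auto
  then show ?thesis unfolding second_singular_value_def by (auto intro: bspec[OF _ nth_mem])
qed

section \<open>Horizontal concatenation and stacked vectors\<close>

lemma hconcat_carrier:
  assumes "\<And>A. A \<in> set As \<Longrightarrow> dim_row A = m"
  shows "hconcat m As \<in> carrier_mat m (sum_list (map dim_col As))"
  using assms by (induction As) (auto simp: hconcat_def)

text \<open>Transposing turns blocks side by side into stacked ones, each acting on the same
  \<open>y\<close>; squared norms then become sums over the transmitters.\<close>

lemma transpose_hconcat_mult_vec:
  assumes "\<And>A. A \<in> set As \<Longrightarrow> dim_row A = m" and "y \<in> carrier_vec m"
  shows "transpose_mat (hconcat m As) *\<^sub>v y = vconcat (map (\<lambda>A. transpose_mat A *\<^sub>v y) As)"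
  using assms(1)
proof (induction As)
  case Nil
  then show ?case by (intro eq_vecI) (auto simp: hconcat_def vconcat_def)
next
  case (Cons A As)
  define H where "H = hconcat m As"
  have H: "dim_row H = m" and A: "dim_row A = m"
    using Cons.prems hconcat_carrier[of As m] unfolding H_def by auto
  have "hconcat m (A # As) = four_block_mat A H (0\<^sub>m 0 (dim_col A)) (0\<^sub>m 0 (dim_col H))"
    unfolding H_def hconcat_def by simp
  moreover have "transpose_mat (four_block_mat A H (0\<^sub>m 0 (dim_col A)) (0\<^sub>m 0 (dim_col H))) *\<^sub>v y
      = (transpose_mat A *\<^sub>v y) @\<^sub>v (transpose_mat H *\<^sub>v y)"
    using A H assms(2) by (intro eq_vecI) (auto simp: scalar_prod_def)
  ultimately show ?case using Cons unfolding H_def by (simp add: vconcat_def)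
qed

lemma vconcat_carrier: "vconcat (map f is) \<in> carrier_vec (\<Sum>i\<leftarrow>is. dim_vec (f i))"
  by (induction "is") (auto simp: vconcat_def)

lemma vconcat_scalar_prod:
  assumes "\<And>i. i \<in> set is \<Longrightarrow> dim_vec (f i) = dim_vec (g i)"
  shows "vconcat (map f is) \<bullet> vconcat (map g is) = (\<Sum>i\<leftarrow>is. f i \<bullet> (g i :: real vec))"
  using assms
proof (induction "is")
  case Nil
  then show ?case by (simp add: vconcat_def scalar_prod_def)
next
  case (Cons i "is")
  have "vconcat (map g is) \<in> carrier_vec (\<Sum>i\<leftarrow>is. dim_vec (f i))"
    using vconcat_carrier[of g "is"] Cons.prems by (simp cong: map_cong)
  then have "(f i @\<^sub>v vconcat (map f is)) \<bullet> (g i @\<^sub>v vconcat (map g is))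
      = f i \<bullet> g i + vconcat (map f is) \<bullet> vconcat (map g is)"
    using vconcat_carrier[of f "is"] Cons.prems[of i]
    by (intro scalar_prod_append) (auto intro: carrier_vecI)
  then show ?case using Cons by (simp add: vconcat_def)
qed

lemma vconcat_eqD:
  assumes "vconcat (map f is) = vconcat (map g is)"
    and "\<And>i. i \<in> set is \<Longrightarrow> dim_vec (f i) = dim_vec (g i)" and "i \<in> set is"
  shows "f i = g i"
  using assms
proof (induction "is")
  case (Cons j "is")
  have "f j @\<^sub>v vconcat (map f is) = g j @\<^sub>v vconcat (map g is)"
    using Cons.prems(1) by (simp add: vconcat_def)
  moreover have "f j \<in> carrier_vec (dim_vec (f j))" by (rule carrier_vec_dim_vec)
  moreover have "g j \<in> carrier_vec (dim_vec (f j))" using Cons.prems(2)[of j] by (intro carrier_vecI) simp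
  ultimately have "f j = g j" "vconcat (map f is) = vconcat (map g is)" using append_vec_eq by metis+
  then show ?case using Cons by auto
qed simp

lemma smult_vconcat: "c \<cdot>\<^sub>v vconcat (map f is) = vconcat (map (\<lambda>i. c \<cdot>\<^sub>v f i) is)"
proof (induction "is")
  case (Cons i "is")
  have "c \<cdot>\<^sub>v (f i @\<^sub>v vconcat (map f is)) = (c \<cdot>\<^sub>v f i) @\<^sub>v (c \<cdot>\<^sub>v vconcat (map f is))"
    by (intro eq_vecI) auto
  then show ?case using Cons by (simp add: vconcat_def)
qed (auto simp: vconcat_def intro: eq_vecI)

text \<open>Collects what is used about the transpose of a divergence transition matrix: it is a
  contraction with \<open>u\<close>, \<open>v\<close> as a singular pair of singular value 1. The
  notion is stable under Kronecker products.\<close>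

definition unit_contraction :: "real mat \<Rightarrow> real vec \<Rightarrow> real vec \<Rightarrow> bool" where
  "unit_contraction M u v \<longleftrightarrow> M \<in> carrier_mat (dim_vec v) (dim_vec u) \<and> M *\<^sub>v u = v
    \<and> transpose_mat M *\<^sub>v v = u \<and> u \<bullet> u = 1
    \<and> (\<forall>y\<in>carrier_vec (dim_vec u). (M *\<^sub>v y) \<bullet> (M *\<^sub>v y) \<le> y \<bullet> y)"

lemma unit_contractionD:
  assumes "unit_contraction M u v"
  shows "M \<in> carrier_mat (dim_vec v) (dim_vec u)" "M *\<^sub>v u = v" "transpose_mat M *\<^sub>v v = u"
    "u \<bullet> u = 1" "\<And>y. y \<in> carrier_vec (dim_vec u) \<Longrightarrow> (M *\<^sub>v y) \<bullet> (M *\<^sub>v y) \<le> y \<bullet> y"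
  using assms unfolding unit_contraction_def by blast+

text \<open>Moving \<open>M\<close> across the scalar product gives
  \<open>v \<bullet> v = v \<bullet> (M u) = u \<bullet> u\<close>.\<close>

lemma unit_contraction_norm_right:
  assumes "unit_contraction M u v"
  shows "v \<bullet> v = 1"
proof -
  note D = unit_contractionD[OF assms]
  have "(transpose_mat M *\<^sub>v v) \<bullet> u = v \<bullet> (M *\<^sub>v u)"
    by (rule transpose_vec_mult_scalar[OF D(1) carrier_vec_dim_vec carrier_vec_dim_vec])
  then show ?thesis unfolding D(2,3) using D(4) by simp
qed

lemma kron_mult_vec_norm:
  assumes A: "A \<in> carrier_mat m n" and B: "B \<in> carrier_mat k l" and y: "y \<in> carrier_vec (n * l)"
  shows "(kron A B *\<^sub>v y) \<bullet> (kron A B *\<^sub>v y)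
    = (\<Sum>c<m. \<Sum>d<k. (\<Sum>a<n. \<Sum>b<l. A $$ (c, a) * B $$ (d, b) * y $ (a * l + b))\<^sup>2)"
proof -
  have "dim_vec (kron A B *\<^sub>v y) = m * k" using A B by simp
  then show ?thesis
    unfolding scalar_prod_self_sum
    by (simp only: sum_lessThan_mult)
      (intro sum.cong refl, simp only: kron_mult_vec_index[OF A B y] lessThan_iff)
qed

lemma mult_vec_norm:
  fixes A :: "real mat"
  assumes "A \<in> carrier_mat m n" "y \<in> carrier_vec n"
  shows "(A *\<^sub>v y) \<bullet> (A *\<^sub>v y) = (\<Sum>c<m. (\<Sum>a<n. A $$ (c, a) * y $ a)\<^sup>2)"
  using assms by (simp add: scalar_prod_self_sum) (simp add: scalar_prod_def lessThan_atLeast0)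

lemma pair_index_norm:
  fixes y :: "real vec"
  assumes "y \<in> carrier_vec (n * l)"
  shows "y \<bullet> y = (\<Sum>a<n. \<Sum>b<l. (y $ (a * l + b))\<^sup>2)"
  using assms by (simp add: scalar_prod_self_sum sum_lessThan_mult)

lemma unit_contraction_sum_le:
  assumes "unit_contraction M u v"
  shows "(\<Sum>c<dim_vec v. (\<Sum>a<dim_vec u. M $$ (c, a) * g a)\<^sup>2) \<le> (\<Sum>a<dim_vec u. (g a)\<^sup>2)"
proof -
  let ?y = "vec (dim_vec u) g"
  have "M \<in> carrier_mat (dim_vec v) (dim_vec u)" "(M *\<^sub>v ?y) \<bullet> (M *\<^sub>v ?y) \<le> ?y \<bullet> ?y"
    using unit_contractionD[OF assms] by simp_all
  then show ?thesis using mult_vec_norm[of M _ _ ?y] by (simp add: scalar_prod_self_sum)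
qed

text \<open>The mixed-product rule multiplies the singular pairs, and the norm bound follows by
  contracting in one index at a time.\<close>

lemma unit_contraction_kron:
  assumes M: "unit_contraction M u v" and C: "unit_contraction C w z"
  shows "unit_contraction (kron M C) (kron_vec u w) (kron_vec v z)"
proof -
  let ?n = "dim_vec u" and ?m = "dim_vec v" and ?l = "dim_vec w" and ?k = "dim_vec z"
  have c: "u \<in> carrier_vec ?n" "v \<in> carrier_vec ?m" "w \<in> carrier_vec ?l" "z \<in> carrier_vec ?k"
    by (rule carrier_vec_dim_vec)+
  note M' = unit_contractionD[OF M] and C' = unit_contractionD[OF C]
  note Mc = M'(1) and Cc = C'(1)
  have tc: "transpose_mat M \<in> carrier_mat ?n ?m" "transpose_mat C \<in> carrier_mat ?l ?k"
    using Mc Cc by auto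
  note bM = unit_contraction_sum_le[OF M] and bC = unit_contraction_sum_le[OF C]
  have "(kron M C *\<^sub>v y) \<bullet> (kron M C *\<^sub>v y) \<le> y \<bullet> y" if y: "y \<in> carrier_vec (?n * ?l)" for y
  proof -
    have "(kron M C *\<^sub>v y) \<bullet> (kron M C *\<^sub>v y)
        \<le> (\<Sum>b<?l. \<Sum>c<?m. (\<Sum>a<?n. M $$ (c, a) * y $ (a * ?l + b))\<^sup>2)"
      unfolding kron_mult_vec_norm[OF Mc Cc y]
      by (rule kron_sum_right_contraction[where M = "\<lambda>c a. M $$ (c, a)" and C = "\<lambda>d b. C $$ (d, b)"
            and Y = "\<lambda>a b. y $ (a * ?l + b)", OF bC])
    also have "\<dots> \<le> (\<Sum>b<?l. \<Sum>a<?n. (y $ (a * ?l + b))\<^sup>2)" by (intro sum_mono bM)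
    also have "\<dots> = y \<bullet> y" unfolding pair_index_norm[OF y] by (rule sum.swap)
    finally show ?thesis .
  qed
  moreover have "kron_vec u w \<bullet> kron_vec u w = 1"
    unfolding kron_vec_scalar_prod[OF c(1,1,3,3)] M'(4) C'(4) by simp
  moreover have "kron M C *\<^sub>v kron_vec u w = kron_vec v z"
    unfolding kron_mult_kron_vec[OF Mc Cc c(1,3)] M'(2) C'(2) ..
  moreover have "transpose_mat (kron M C) *\<^sub>v kron_vec v z = kron_vec u w"
    unfolding transpose_kron kron_mult_kron_vec[OF tc c(2,4)] M'(3) C'(3) ..
  moreover have "dim_vec (kron_vec u w) = ?n * ?l" "dim_vec (kron_vec v z) = ?m * ?k"
    by (simp_all add: kron_vec_def)
  ultimately show ?thesis
    using kron_carrier[OF Mc Cc] unfolding unit_contraction_def by simp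
qed

lemma kron_vec_pow_unit:
  assumes "u \<bullet> u = 1"
  shows "kron_vec_pow u n \<bullet> kron_vec_pow u n = 1"
proof (induction n)
  case 0
  show ?case by (auto simp: scalar_prod_def)
next
  case (Suc n)
  have "kron_vec u (kron_vec_pow u n) \<bullet> kron_vec u (kron_vec_pow u n)
      = (u \<bullet> u) * (kron_vec_pow u n \<bullet> kron_vec_pow u n)"
    by (rule kron_vec_scalar_prod[OF carrier_vec_dim_vec carrier_vec_dim_vec
          carrier_vec_dim_vec carrier_vec_dim_vec])
  then show ?case using assms Suc by simp
qed

lemma unit_contraction_kron_pow:
  assumes "unit_contraction M u v"
  shows "unit_contraction (kron_pow M n) (kron_vec_pow u n) (kron_vec_pow v n)"
proof (induction n)
  case 0
  show ?case by (auto simp: unit_contraction_def scalar_prod_def)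
next
  case (Suc n)
  then show ?case using unit_contraction_kron[OF assms Suc] by simp
qed

text \<open>With \<open>M i\<close> the transposed blocks of a concatenation and \<open>u\<close>
  its top left singular vector, this is the condition that the square of the second singular value
  is at most \<open>t\<close>, for \<open>t\<close> a square.\<close>

definition perp_bound :: "nat set \<Rightarrow> (nat \<Rightarrow> real mat) \<Rightarrow> real vec \<Rightarrow> real \<Rightarrow> bool" where
  "perp_bound I M u t \<longleftrightarrow> (\<forall>y\<in>carrier_vec (dim_vec u). y \<bullet> u = 0 \<longrightarrow>
    (\<Sum>i\<in>I. (M i *\<^sub>v y) \<bullet> (M i *\<^sub>v y)) \<le> t * (y \<bullet> y))"

lemma perp_bound_sum:
  assumes "perp_bound I M u t" "\<And>i. i \<in> I \<Longrightarrow> M i \<in> carrier_mat (m i) (dim_vec u)"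
    and "(\<Sum>a<dim_vec u. f a * u $ a) = 0"
  shows "(\<Sum>i\<in>I. \<Sum>c<m i. (\<Sum>a<dim_vec u. M i $$ (c, a) * f a)\<^sup>2) \<le> t * (\<Sum>a<dim_vec u. (f a)\<^sup>2)"
proof -
  let ?y = "vec (dim_vec u) f"
  have "?y \<bullet> u = 0" using assms(3) by (simp add: scalar_prod_def lessThan_atLeast0)
  then have "(\<Sum>i\<in>I. (M i *\<^sub>v ?y) \<bullet> (M i *\<^sub>v ?y)) \<le> t * (?y \<bullet> ?y)"
    using assms(1) unfolding perp_bound_def by simp
  then show ?thesis using mult_vec_norm[OF assms(2), of _ ?y] by (simp add: scalar_prod_self_sum)
qed

text \<open>\<open>kron_sum_bound\<close> in matrix form. Both factors satisfy the bound with the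
  same \<open>t\<close>, and the product inherits it without loss, which makes an induction on the
  power possible.\<close>

lemma perp_bound_kron:
  assumes M: "\<And>i. i \<in> I \<Longrightarrow> unit_contraction (M i) u (v i)"
    and C: "\<And>i. i \<in> I \<Longrightarrow> unit_contraction (C i) w (z i)" and u1: "u \<bullet> u = 1"
    and bM: "perp_bound I M u t" and bC: "perp_bound I C w t"
  shows "perp_bound I (\<lambda>i. kron (M i) (C i)) (kron_vec u w) t"
  unfolding perp_bound_def
proof (intro ballI impI)
  let ?n = "dim_vec u" and ?m = "\<lambda>i. dim_vec (v i)" and ?l = "dim_vec w" and ?k = "\<lambda>i. dim_vec (z i)"
  fix y assume "y \<in> carrier_vec (dim_vec (kron_vec u w))" and yu: "y \<bullet> kron_vec u w = 0"
  then have y: "y \<in> carrier_vec (?n * ?l)" by (simp add: kron_vec_def)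
  have c: "u \<in> carrier_vec ?n" "w \<in> carrier_vec ?l" by (rule carrier_vec_dim_vec)+
  have Mc: "M i \<in> carrier_mat (?m i) ?n" and Cc: "C i \<in> carrier_mat (?k i) ?l" if "i \<in> I" for i
    using unit_contractionD(1)[OF M[OF that]] unit_contractionD(1)[OF C[OF that]] by simp_all
  have "(\<Sum>i\<in>I. (kron (M i) (C i) *\<^sub>v y) \<bullet> (kron (M i) (C i) *\<^sub>v y))
    = (\<Sum>i\<in>I. \<Sum>c<?m i. \<Sum>d<?k i. (\<Sum>a<?n. \<Sum>b<?l. M i $$ (c, a) * C i $$ (d, b) * y $ (a * ?l + b))\<^sup>2)"
    using kron_mult_vec_norm[OF Mc Cc y] by (intro sum.cong) auto
  also have "\<dots> \<le> t * (\<Sum>a<?n. \<Sum>b<?l. (y $ (a * ?l + b))\<^sup>2)"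
  proof (rule kron_sum_bound[where u = "($) u" and v = "\<lambda>i. ($) (v i)" and w = "($) w"])
    show "(\<Sum>a<?n. (u $ a)\<^sup>2) = 1" using u1 by (simp add: scalar_prod_self_sum)
  next
    fix i assume "i \<in> I"
    then show "(\<Sum>c<?m i. (v i $ c)\<^sup>2) = 1"
      using unit_contraction_norm_right[OF M] by (simp add: scalar_prod_self_sum)
  next
    fix i c assume i: "i \<in> I" "c \<in> {..<?m i}"
    have "(M i *\<^sub>v u) $ c = (\<Sum>a<?n. M i $$ (c, a) * u $ a)"
      using Mc[OF i(1)] i by (simp add: scalar_prod_def lessThan_atLeast0)
    then show "(\<Sum>a<?n. M i $$ (c, a) * u $ a) = v i $ c"
      using unit_contractionD(2,3)[OF M[OF i(1)]] by simp
  next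
    fix i a assume i: "i \<in> I" "a \<in> {..<?n}"
    have "(transpose_mat (M i) *\<^sub>v v i) $ a = (\<Sum>c<?m i. M i $$ (c, a) * v i $ c)"
      using Mc[OF i(1)] i by (simp add: scalar_prod_def lessThan_atLeast0)
    then show "(\<Sum>c<?m i. M i $$ (c, a) * v i $ c) = u $ a"
      using unit_contractionD(2,3)[OF M[OF i(1)]] by simp
  next
    fix i g assume i: "i \<in> I"
    show "(\<Sum>d<?k i. (\<Sum>b<?l. C i $$ (d, b) * g b)\<^sup>2) \<le> (\<Sum>b<?l. (g b)\<^sup>2)"
      by (rule unit_contraction_sum_le[OF C[OF i]])
  next
    fix f assume s: "(\<Sum>a<?n. f a * u $ a) = 0"
    show "(\<Sum>i\<in>I. \<Sum>c<?m i. (\<Sum>a<?n. M i $$ (c, a) * f a)\<^sup>2) \<le> t * (\<Sum>a<?n. (f a)\<^sup>2)"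
      by (rule perp_bound_sum[OF bM Mc s])
  next
    fix f assume s: "(\<Sum>a<?l. f a * w $ a) = 0"
    show "(\<Sum>i\<in>I. \<Sum>c<?k i. (\<Sum>a<?l. C i $$ (c, a) * f a)\<^sup>2) \<le> t * (\<Sum>a<?l. (f a)\<^sup>2)"
      by (rule perp_bound_sum[OF bC Cc s])
  next
    have "y \<bullet> kron_vec u w = (\<Sum>j<?n * ?l. y $ j * kron_vec u w $ j)"
      by (simp add: scalar_prod_def kron_vec_def lessThan_atLeast0)
    also have "\<dots> = (\<Sum>a<?n. \<Sum>b<?l. y $ (a * ?l + b) * (u $ a * w $ b))"
      unfolding sum_lessThan_mult by (intro sum.cong refl) (simp add: kron_vec_index[OF c])
    finally show "(\<Sum>a<?n. \<Sum>b<?l. y $ (a * ?l + b) * (u $ a * w $ b)) = 0" using yu by simp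
  qed
  also have "\<dots> = t * (y \<bullet> y)" unfolding pair_index_norm[OF y] ..
  finally show "(\<Sum>i\<in>I. (kron (M i) (C i) *\<^sub>v y) \<bullet> (kron (M i) (C i) *\<^sub>v y)) \<le> t * (y \<bullet> y)" .
qed

text \<open>Upwards, one factor is added at a time with \<open>t\<close> unchanged. Downwards, the
  bound is tested on \<open>y\<close> times a power of \<open>u\<close>, whose image is
  \<open>M i y\<close> times a power of the unit vector \<open>v i\<close>, so all norms are those
  of the first factor. The latter requires at least one factor.\<close>

lemma perp_bound_kron_pow_iff:
  assumes M: "\<And>i. i \<in> I \<Longrightarrow> unit_contraction (M i) u (v i)" and u1: "u \<bullet> u = 1" and n: "1 \<le> n"
  shows "perp_bound I (\<lambda>i. kron_pow (M i) n) (kron_vec_pow u n) t \<longleftrightarrow> perp_bound I M u t"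
proof
  assume b: "perp_bound I M u t"
  show "perp_bound I (\<lambda>i. kron_pow (M i) n) (kron_vec_pow u n) t"
  proof (induction n)
    case 0
    show ?case
      unfolding perp_bound_def
    proof (intro ballI impI)
      fix y assume "y \<in> carrier_vec (dim_vec (kron_vec_pow u 0))" "y \<bullet> kron_vec_pow u 0 = 0"
      \<comment> \<open>The empty power lives in a one-dimensional space spanned by
        \<open>kron_vec_pow u 0\<close>, so its complement is trivial and the induction can start at
        0.\<close>
      then have "y = 0\<^sub>v 1" by (intro eq_vecI) (auto simp: scalar_prod_def)
      then show "(\<Sum>i\<in>I. (kron_pow (M i) 0 *\<^sub>v y) \<bullet> (kron_pow (M i) 0 *\<^sub>v y)) \<le> t * (y \<bullet> y)" by simp
    qed
  next
    case (Suc n)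
    show ?case
      using perp_bound_kron[OF M unit_contraction_kron_pow[OF M] u1 b Suc] by simp
  qed
next
  obtain m where m: "n = Suc m" using n by (cases n) auto
  assume b: "perp_bound I (\<lambda>i. kron_pow (M i) n) (kron_vec_pow u n) t"
  let ?w = "kron_vec_pow u m"
  have c: "u \<in> carrier_vec (dim_vec u)" "?w \<in> carrier_vec (dim_vec ?w)" by (rule carrier_vec_dim_vec)+
  have w1: "?w \<bullet> ?w = 1" by (rule kron_vec_pow_unit[OF u1])
  show "perp_bound I M u t"
    unfolding perp_bound_def
  proof (intro ballI impI)
    fix y assume y: "y \<in> carrier_vec (dim_vec u)" "y \<bullet> u = 0"
    have "kron_vec y ?w \<bullet> kron_vec_pow u n = 0"
      unfolding m using kron_vec_scalar_prod[OF y(1) c(1) c(2,2)] y by simp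
    moreover have "kron_vec y ?w \<in> carrier_vec (dim_vec (kron_vec_pow u n))"
      unfolding m using kron_vec_carrier[OF y(1) c(2)] by (simp add: kron_vec_def)
    ultimately have "(\<Sum>i\<in>I. (kron_pow (M i) n *\<^sub>v kron_vec y ?w) \<bullet> (kron_pow (M i) n *\<^sub>v kron_vec y ?w))
        \<le> t * (kron_vec y ?w \<bullet> kron_vec y ?w)"
      using b unfolding perp_bound_def by blast
    also have "\<dots> = t * (y \<bullet> y)" using kron_vec_scalar_prod[OF y(1,1) c(2,2)] w1 by simp
    also have "(\<Sum>i\<in>I. (kron_pow (M i) n *\<^sub>v kron_vec y ?w) \<bullet> (kron_pow (M i) n *\<^sub>v kron_vec y ?w))
        = (\<Sum>i\<in>I. (M i *\<^sub>v y) \<bullet> (M i *\<^sub>v y))"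
    proof (rule sum.cong[OF refl])
      fix i assume i: "i \<in> I"
      let ?z = "kron_vec_pow (v i) m"
      note pc = unit_contraction_kron_pow[OF M[OF i], of m]
      have Mc: "M i \<in> carrier_mat (dim_vec (v i)) (dim_vec u)"
        by (rule unit_contractionD(1)[OF M[OF i]])
      have Pc: "kron_pow (M i) m \<in> carrier_mat (dim_vec ?z) (dim_vec ?w)"
        and Pw: "kron_pow (M i) m *\<^sub>v ?w = ?z"
        using unit_contractionD(1,2)[OF pc] by simp_all
      have My: "M i *\<^sub>v y \<in> carrier_vec (dim_vec (v i))" "?z \<in> carrier_vec (dim_vec ?z)"
        using mult_mat_vec_carrier[OF Mc y(1)] by simp_all
      have "kron_pow (M i) n *\<^sub>v kron_vec y ?w = kron_vec (M i *\<^sub>v y) ?z"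
        unfolding m using kron_mult_kron_vec[OF Mc Pc y(1) c(2)] Pw by simp
      then show "(kron_pow (M i) n *\<^sub>v kron_vec y ?w) \<bullet> (kron_pow (M i) n *\<^sub>v kron_vec y ?w)
          = (M i *\<^sub>v y) \<bullet> (M i *\<^sub>v y)"
        using kron_vec_scalar_prod[OF My(1,1) My(2,2)] unit_contraction_norm_right[OF pc] by simp
    qed
    finally show "(\<Sum>i\<in>I. (M i *\<^sub>v y) \<bullet> (M i *\<^sub>v y)) \<le> t * (y \<bullet> y)" .
  qed
qed

text \<open>The vectors \<open>v i\<close> stacked form the top right singular vector: the
  transposed concatenation sends \<open>u\<close> to it, and each of the \<open>k\<close> blocks
  sends its part back to \<open>u\<close>. Hence the top squared singular value is \<open>k\<close>,
  the upper bound being contractivity summed over the blocks.\<close>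

lemma second_singular_value_hconcat_le_iff:
  assumes k: "1 \<le> k" and m: "u \<in> carrier_vec m" "u \<bullet> u = 1"
    and B: "\<And>i. i < k \<Longrightarrow> unit_contraction (transpose_mat (B i)) u (v i)" and s: "0 \<le> s"
  shows "second_singular_value (hconcat m (map B [0..<k])) \<le> s
    \<longleftrightarrow> perp_bound {..<k} (\<lambda>i. transpose_mat (B i)) u (s\<^sup>2)"
proof -
  define A where "A = hconcat m (map B [0..<k])"
  have Bc: "B i \<in> carrier_mat m (dim_vec (v i))" if "i < k" for i
    using unit_contractionD(1)[OF B[OF that]] m by simp
  define n where "n = (\<Sum>i\<leftarrow>[0..<k]. dim_vec (v i))"
  have e: "map dim_col (map B [0..<k]) = map (\<lambda>i. dim_vec (v i)) [0..<k]"
    using carrier_matD(2)[OF Bc] by simp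
  have A: "A \<in> carrier_mat m n"
    unfolding A_def n_def e[symmetric] using carrier_matD(1)[OF Bc] by (intro hconcat_carrier) auto
  have tA: "transpose_mat A *\<^sub>v y = vconcat (map (\<lambda>i. transpose_mat (B i) *\<^sub>v y) [0..<k])"
    if "y \<in> carrier_vec m" for y
  proof -
    have "transpose_mat A *\<^sub>v y = vconcat (map (\<lambda>M. transpose_mat M *\<^sub>v y) (map B [0..<k]))"
      unfolding A_def by (rule transpose_hconcat_mult_vec) (use carrier_matD(1)[OF Bc] that in auto)
    then show ?thesis by (simp add: o_def)
  qed
  define x where "x = vconcat (map v [0..<k])"
  have x: "x \<in> carrier_vec n" unfolding x_def n_def by (rule vconcat_carrier)
  have Bu: "transpose_mat (B i) *\<^sub>v u = v i" "B i *\<^sub>v v i = u" if "i < k" for i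
    using unit_contractionD(2,3)[OF B[OF that]] by simp_all
  have Au: "transpose_mat A *\<^sub>v u = x"
    unfolding tA[OF m(1)] x_def using Bu by (intro arg_cong[of _ _ vconcat]) auto
  \<comment> \<open>Only the transpose of \<open>A\<close> has been described blockwise, so
    \<open>A x\<close> is computed by pairing with test vectors; unit vectors then recover its
    entries.\<close>
  have Ax: "(A *\<^sub>v x) \<bullet> w = real k * (u \<bullet> w)" if w: "w \<in> carrier_vec m" for w
  proof -
    have "(A *\<^sub>v x) \<bullet> w = (transpose_mat A *\<^sub>v w) \<bullet> x"
      using transpose_vec_mult_scalar[OF A x w] comm_scalar_prod[OF w mult_mat_vec_carrier[OF A x]] by simp
    also have "\<dots> = (\<Sum>i\<leftarrow>[0..<k]. (transpose_mat (B i) *\<^sub>v w) \<bullet> v i)"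
      unfolding tA[OF w] x_def using Bc by (intro vconcat_scalar_prod) auto
    also have "\<dots> = (\<Sum>i\<leftarrow>[0..<k]. u \<bullet> w)"
    proof (intro arg_cong[of _ _ sum_list] map_cong refl)
      fix i assume "i \<in> set [0..<k]"
      then have i: "i < k" by simp
      show "(transpose_mat (B i) *\<^sub>v w) \<bullet> v i = u \<bullet> w"
        using transpose_vec_mult_scalar[OF Bc[OF i] carrier_vec_dim_vec w] Bu[OF i] comm_scalar_prod[OF w m(1)]
        by simp
    qed
    also have "\<dots> = real k * (u \<bullet> w)" by (simp add: sum_list_triv)
    finally show ?thesis .
  qed
  have Ax': "A *\<^sub>v x = real k \<cdot>\<^sub>v u"
  proof (rule eq_vecI)
    fix j assume "j < dim_vec (real k \<cdot>\<^sub>v u)"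
    then have j: "j < m" using m by simp
    show "(A *\<^sub>v x) $ j = (real k \<cdot>\<^sub>v u) $ j"
      using Ax[of "unit_vec m j"] j m mult_mat_vec_carrier[OF A x] by simp
  qed (use A m in auto)
  have N: "(transpose_mat A *\<^sub>v y) \<bullet> (transpose_mat A *\<^sub>v y)
      = (\<Sum>i<k. (transpose_mat (B i) *\<^sub>v y) \<bullet> (transpose_mat (B i) *\<^sub>v y))" if "y \<in> carrier_vec m" for y
    unfolding tA[OF that] by (subst vconcat_scalar_prod) (simp_all add: sum_list_distinct_conv_sum_set lessThan_atLeast0)
  have "(transpose_mat A *\<^sub>v y) \<bullet> (transpose_mat A *\<^sub>v y) \<le> real k * (y \<bullet> y)" if y: "y \<in> carrier_vec m" for y
  proof -
    have "(\<Sum>i<k. (transpose_mat (B i) *\<^sub>v y) \<bullet> (transpose_mat (B i) *\<^sub>v y)) \<le> (\<Sum>i<k. y \<bullet> y)"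
      using unit_contractionD(5)[OF B] y m by (intro sum_mono) simp
    then show ?thesis using N[OF y] by simp
  qed
  from second_singular_value_le_iff_transpose[OF A x m _ Ax' Au this s] k
  show ?thesis using N m unfolding A_def perp_bound_def by auto
qed

text \<open>Both values are nonnegative and have the same nonnegative upper bounds, so each bounds
  the other.\<close>

lemma second_singular_value_hconcat_kron_pow:
  assumes k: "1 \<le> k" and u: "u \<in> carrier_vec m" "u \<bullet> u = 1" and n: "1 \<le> n"
    and B: "\<And>i. i < k \<Longrightarrow> unit_contraction (transpose_mat (B i)) u (v i)"
  shows "second_singular_value (hconcat (m ^ n) (map (\<lambda>i. kron_pow (B i) n) [0..<k]))
    = second_singular_value (hconcat m (map B [0..<k]))" (is "?a = ?b")
proof -
  have p: "unit_contraction (transpose_mat (kron_pow (B i) n)) (kron_vec_pow u n) (kron_vec_pow (v i) n)"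
    if "i < k" for i
    unfolding transpose_kron_pow by (rule unit_contraction_kron_pow[OF B[OF that]])
  have "?a \<le> s \<longleftrightarrow> ?b \<le> s" if "0 \<le> s" for s
    using second_singular_value_hconcat_le_iff[OF k kron_vec_pow_carrier[OF u(1)] kron_vec_pow_unit[OF u(2)] p that]
      second_singular_value_hconcat_le_iff[OF k u B that]
      perp_bound_kron_pow_iff[of "{..<k}" "\<lambda>i. transpose_mat (B i)" u v n "s\<^sup>2"] B u n
    by (simp add: transpose_kron_pow)
  then show ?thesis using second_singular_value_nonneg order_antisym by (metis order_refl)
qed

section \<open>Divergence transition matrices\<close>

text \<open>After rescaling by \<open>sqrt (p a)\<close> and \<open>sqrt (s y)\<close>, the
  transpose is a conditional expectation: it averages functions of the output over the law
  \<open>w\<close> given \<open>a\<close>. Constants are preserved, which gives the singular pair,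
  and Cauchy-Schwarz within each average gives contractivity.\<close>

lemma unit_contraction_transpose_stochastic:
  fixes w :: "nat \<Rightarrow> nat \<Rightarrow> real"
  assumes w0: "\<And>y a. y < r \<Longrightarrow> a < n \<Longrightarrow> 0 \<le> w y a" and w1: "\<And>a. a < n \<Longrightarrow> (\<Sum>y<r. w y a) = 1"
    and p0: "\<And>a. a < n \<Longrightarrow> 0 \<le> p a" and p1: "(\<Sum>a<n. p a) = 1"
    and s0: "\<And>y. y < r \<Longrightarrow> 0 < s y" and s: "\<And>y. y < r \<Longrightarrow> (\<Sum>a<n. w y a * p a) = s y"
  shows "unit_contraction (transpose_mat (mat r n (\<lambda>(y, a). w y a * sqrt (p a) / sqrt (s y))))
    (vec r (\<lambda>y. sqrt (s y))) (vec n (\<lambda>a. sqrt (p a)))"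
proof -
  define B where "B = mat r n (\<lambda>(y, a). w y a * sqrt (p a) / sqrt (s y))"
  let ?u = "vec r (\<lambda>y. sqrt (s y))" and ?v = "vec n (\<lambda>a. sqrt (p a))"
  have B: "B \<in> carrier_mat r n" unfolding B_def by simp
  have Bty: "(transpose_mat B *\<^sub>v y) $ a = (\<Sum>j<r. w j a * sqrt (p a) / sqrt (s j) * y $ j)"
    if "y \<in> carrier_vec r" "a < n" for y a
    using that by (simp add: B_def scalar_prod_def lessThan_atLeast0)
  have "transpose_mat B *\<^sub>v ?u = ?v"
  proof (rule eq_vecI)
    fix a assume "a < dim_vec ?v"
    then have a: "a < n" by simp
    have "(transpose_mat B *\<^sub>v ?u) $ a = (\<Sum>j<r. w j a * sqrt (p a) / sqrt (s j) * sqrt (s j))"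
      using Bty[of ?u a] a by simp
    also have "\<dots> = (\<Sum>j<r. w j a * sqrt (p a))"
    proof (rule sum.cong[OF refl])
      fix j assume "j \<in> {..<r}"
      then have "sqrt (s j) \<noteq> 0" using s0[of j] by auto
      then show "w j a * sqrt (p a) / sqrt (s j) * sqrt (s j) = w j a * sqrt (p a)" by simp
    qed
    also have "\<dots> = sqrt (p a)" unfolding sum_distrib_right[symmetric] w1[OF a] by simp
    finally show "(transpose_mat B *\<^sub>v ?u) $ a = ?v $ a" using a by simp
  qed (use B in auto)
  moreover have "B *\<^sub>v ?v = ?u"
  proof (rule eq_vecI)
    fix y assume "y < dim_vec ?u"
    then have y: "y < r" by simp
    have "(B *\<^sub>v ?v) $ y = (\<Sum>a<n. w y a * sqrt (p a) / sqrt (s y) * sqrt (p a))"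
      using y by (simp add: B_def scalar_prod_def lessThan_atLeast0)
    also have "\<dots> = (\<Sum>a<n. w y a * p a / sqrt (s y))"
    proof (rule sum.cong[OF refl])
      fix a assume "a \<in> {..<n}"
      then have "sqrt (p a) * sqrt (p a) = p a" using p0[of a] by simp
      then show "w y a * sqrt (p a) / sqrt (s y) * sqrt (p a) = w y a * p a / sqrt (s y)"
        by (simp add: mult.assoc)
    qed
    also have "\<dots> = s y / sqrt (s y)" unfolding sum_divide_distrib[symmetric] s[OF y] ..
    also have "\<dots> = sqrt (s y)" using s0[OF y] by (simp add: real_div_sqrt)
    finally show "(B *\<^sub>v ?v) $ y = ?u $ y" using y by simp
  qed (use B in auto)
  moreover have "?u \<bullet> ?u = 1"
  proof -
    have "?u \<bullet> ?u = (\<Sum>y<r. s y)"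
      using s0 by (simp add: scalar_prod_self_sum less_imp_le)
    also have "\<dots> = (\<Sum>y<r. \<Sum>a<n. w y a * p a)" using s by simp
    also have "\<dots> = (\<Sum>a<n. \<Sum>y<r. w y a * p a)" by (rule sum.swap)
    also have "\<dots> = 1" unfolding sum_distrib_right[symmetric] using w1 p1 by simp
    finally show ?thesis .
  qed
  moreover have "(transpose_mat B *\<^sub>v y) \<bullet> (transpose_mat B *\<^sub>v y) \<le> y \<bullet> y" if y: "y \<in> carrier_vec r" for y
  proof -
    have "(transpose_mat B *\<^sub>v y) \<bullet> (transpose_mat B *\<^sub>v y)
        = (\<Sum>a<n. (\<Sum>j<r. w j a * sqrt (p a) / sqrt (s j) * y $ j)\<^sup>2)"
      using B Bty[OF y] by (simp add: scalar_prod_self_sum)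
    also have "\<dots> \<le> (\<Sum>a<n. \<Sum>j<r. w j a * p a * ((y $ j)\<^sup>2 / s j))"
    proof (rule sum_mono)
      fix a assume "a \<in> {..<n}"
      then have a: "a < n" by simp
      \<comment> \<open>Splitting \<open>w j a\<close> into two square roots leaves a Cauchy-Schwarz
        factor that sums to 1, because column \<open>a\<close> of \<open>w\<close> is a probability
        distribution.\<close>
      let ?g = "\<lambda>j. sqrt (w j a) * (sqrt (p a) / sqrt (s j) * y $ j)"
      have "(\<Sum>j<r. w j a * sqrt (p a) / sqrt (s j) * y $ j) = (\<Sum>j<r. sqrt (w j a) * ?g j)"
      proof (rule sum.cong[OF refl])
        fix j assume "j \<in> {..<r}"
        then have "sqrt (w j a) * sqrt (w j a) = w j a" using w0[of j a] a by simp
        then show "w j a * sqrt (p a) / sqrt (s j) * y $ j = sqrt (w j a) * ?g j"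
          by (metis mult.assoc times_divide_eq_right)
      qed
      then have "(\<Sum>j<r. w j a * sqrt (p a) / sqrt (s j) * y $ j)\<^sup>2
          \<le> (\<Sum>j<r. (sqrt (w j a))\<^sup>2) * (\<Sum>j<r. (?g j)\<^sup>2)"
        using sum_Cauchy_Schwarz[of "{..<r}" "\<lambda>j. sqrt (w j a)" ?g] by simp
      also have "(\<Sum>j<r. (sqrt (w j a))\<^sup>2) = 1" using w0 a w1[OF a] by simp
      also have "(\<Sum>j<r. (?g j)\<^sup>2) = (\<Sum>j<r. w j a * p a * ((y $ j)\<^sup>2 / s j))"
        using w0 a p0[OF a] s0 by (intro sum.cong refl) (simp add: power_mult_distrib power_divide less_imp_le)
      finally show "(\<Sum>j<r. w j a * sqrt (p a) / sqrt (s j) * y $ j)\<^sup>2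
          \<le> (\<Sum>j<r. w j a * p a * ((y $ j)\<^sup>2 / s j))" by simp
    qed
    also have "\<dots> = (\<Sum>j<r. \<Sum>a<n. w j a * p a * ((y $ j)\<^sup>2 / s j))" by (rule sum.swap)
    \<comment> \<open>Averaging the columns over \<open>p\<close> restores the output probability
      \<open>s j\<close>, which cancels the denominator.\<close>
    also have "\<dots> = (\<Sum>j<r. s j * ((y $ j)\<^sup>2 / s j))"
      unfolding sum_distrib_right[symmetric] using s by simp
    also have "\<dots> = (\<Sum>j<r. (y $ j)\<^sup>2)"
    proof (rule sum.cong[OF refl])
      fix j assume "j \<in> {..<r}"
      then show "s j * ((y $ j)\<^sup>2 / s j) = (y $ j)\<^sup>2" using s0[of j] by simp
    qed
    also have "\<dots> = y \<bullet> y" using y by (simp add: scalar_prod_self_sum)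
    finally show ?thesis .
  qed
  ultimately show ?thesis
    unfolding unit_contraction_def B_def[symmetric] using B by simp
qed

section \<open>Sums over joint inputs and the marginal channels\<close>

lemma finite_inputs: "finite (inputs k q)"
  unfolding inputs_def by (intro finite_PiE) auto

lemma sum_inputs_prod: "(\<Sum>x\<in>inputs k q. \<Prod>j<k. f j (x j)) = (\<Prod>j<k. \<Sum>a<q j. f j a)"
  for f :: "nat \<Rightarrow> nat \<Rightarrow> real"
  unfolding inputs_def by (subst prod_sum_PiE) auto

text \<open>Putting the indicator of \<open>a\<close> in place of the missing factor
  \<open>i\<close> turns the restricted sum into a full one, which factors into sums equal to
  1.\<close>

lemma sum_inputs_prod_others:
  fixes P :: "nat \<Rightarrow> nat \<Rightarrow> real"
  assumes P1: "\<And>i. i < k \<Longrightarrow> (\<Sum>a<q i. P i a) = 1" and i: "i < k" and a: "a < q i"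
  shows "(\<Sum>x | x \<in> inputs k q \<and> x i = a. \<Prod>j\<in>{..<k} - {i}. P j (x j)) = 1"
proof -
  define f where "f j b = (if j = i then if b = a then 1 else 0 else P j b)" for j b
  have "(\<Prod>j<k. f j (x j)) = (if x i = a then \<Prod>j\<in>{..<k} - {i}. P j (x j) else 0)" for x
  proof -
    have "(\<Prod>j<k. f j (x j)) = f i (x i) * (\<Prod>j\<in>{..<k} - {i}. f j (x j))"
      using i by (simp add: prod.remove)
    also have "(\<Prod>j\<in>{..<k} - {i}. f j (x j)) = (\<Prod>j\<in>{..<k} - {i}. P j (x j))"
      by (intro prod.cong) (auto simp: f_def)
    finally show ?thesis by (simp add: f_def)
  qed
  then have "(\<Sum>x | x \<in> inputs k q \<and> x i = a. \<Prod>j\<in>{..<k} - {i}. P j (x j))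
      = (\<Sum>x\<in>inputs k q. \<Prod>j<k. f j (x j))"
    by (simp add: sum.inter_filter[OF finite_inputs])
  also have "\<dots> = (\<Prod>j<k. \<Sum>b<q j. f j b)" by (rule sum_inputs_prod)
  also have "\<dots> = 1"
  proof (intro prod.neutral ballI)
    fix j assume "j \<in> {..<k}"
    then show "(\<Sum>b<q j. f j b) = 1" using P1[of j] a by (cases "j = i") (auto simp: f_def)
  qed
  finally show ?thesis .
qed

text \<open>Each marginal channel is stochastic because the probabilities of the other inputs sum to
  1, and averaging it over \<open>P i\<close> regroups the joint inputs by their letter at
  \<open>i\<close>, which yields the output distribution.\<close>

lemma unit_contraction_transpose_dtm:
  assumes P0: "\<And>i a. i < k \<Longrightarrow> a < q i \<Longrightarrow> 0 < P i a"
    and P1: "\<And>i. i < k \<Longrightarrow> (\<Sum>a<q i. P i a) = 1"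
    and W0: "\<And>x y. x \<in> inputs k q \<Longrightarrow> y < r \<Longrightarrow> 0 \<le> W y x"
    and W1: "\<And>x y. x \<in> inputs k q \<Longrightarrow> (\<Sum>y<r. W y x) = 1"
    and Y: "\<And>y. y < r \<Longrightarrow> 0 < output_dist k q P W y" and i: "i < k"
  shows "unit_contraction (transpose_mat (dtm k q r P W i))
    (vec r (\<lambda>y. sqrt (output_dist k q P W y))) (sqrt_dist q P i)"
  unfolding dtm_def sqrt_dist_def
proof (rule unit_contraction_transpose_stochastic)
  let ?X = "\<lambda>a. {x \<in> inputs k q. x i = a}" and ?Q = "\<lambda>x. \<Prod>j\<in>{..<k} - {i}. P j (x j)"
  have xq: "x j < q j" if "x \<in> inputs k q" "j < k" for x j
    using that unfolding inputs_def by auto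
  have P': "0 \<le> ?Q x" if "x \<in> inputs k q" for x
    using P0 xq[OF that] by (intro prod_nonneg) (auto intro: less_imp_le)
  show "0 \<le> marg_channel k q P W i y a" if "y < r" for y a
    unfolding marg_channel_def using W0 P' that by (intro sum_nonneg) auto
  show "(\<Sum>y<r. marg_channel k q P W i y a) = 1" if a: "a < q i" for a
  proof -
    have "(\<Sum>y<r. marg_channel k q P W i y a) = (\<Sum>x\<in>?X a. \<Sum>y<r. W y x * ?Q x)"
      unfolding marg_channel_def by (rule sum.swap)
    also have "\<dots> = (\<Sum>x\<in>?X a. ?Q x)"
      unfolding sum_distrib_right[symmetric] using W1 by simp
    also have "\<dots> = 1" using P1 i a by (rule sum_inputs_prod_others)
    finally show ?thesis .
  qed
  show "0 \<le> P i a" if "a < q i" for a using P0[OF i that] by simp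
  show "(\<Sum>a<q i. P i a) = 1" by (rule P1[OF i])
  show "0 < output_dist k q P W y" if "y < r" for y by (rule Y[OF that])
  show "(\<Sum>a<q i. marg_channel k q P W i y a * P i a) = output_dist k q P W y" for y
  proof -
    have "(\<Sum>a<q i. marg_channel k q P W i y a * P i a)
        = (\<Sum>a<q i. \<Sum>x\<in>?X a. W y x * (\<Prod>j<k. P j (x j)))"
      unfolding marg_channel_def sum_distrib_right using i
      by (intro sum.cong refl) (simp add: prod.remove[of "{..<k}" i] ac_simps)
    also have "\<dots> = output_dist k q P W y"
      unfolding output_dist_def using xq i by (intro sum.group[OF finite_inputs]) auto
    finally show ?thesis .
  qed
qed

text \<open>Orthogonality to the stacked \<open>sqrt_dist\<close> vectors is the choice made in a
  singular value decomposition; it matters when the top singular value is repeated. The case of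
  value 0 with several transmitters is excluded: the vector with blocks
  \<open>sqrt_dist q P 0\<close>, \<open>- sqrt_dist q P 1\<close> and zeros is in the kernel and
  orthogonal to the top vector, but its blocks are not orthogonal to theirs.\<close>

theorem theorem2:
  fixes k r :: nat
    and q :: "nat \<Rightarrow> nat"
    and P :: "nat \<Rightarrow> nat \<Rightarrow> real"
    and W :: "nat \<Rightarrow> (nat \<Rightarrow> nat) \<Rightarrow> real"
  assumes "1 \<le> k"
    and "\<And>i a. i < k \<Longrightarrow> a < q i \<Longrightarrow> 0 < P i a"
    and "\<And>i. i < k \<Longrightarrow> (\<Sum>a<q i. P i a) = 1"
    and "\<And>x y. x \<in> inputs k q \<Longrightarrow> y < r \<Longrightarrow> 0 \<le> W y x"
    and "\<And>x. x \<in> inputs k q \<Longrightarrow> (\<Sum>y<r. W y x) = 1"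
    and "\<And>y. y < r \<Longrightarrow> 0 < output_dist k q P W y"
  shows "(\<forall>n\<ge>1. second_singular_value (concat_dtm k q r P W n)
                = second_singular_value (concat_dtm k q r P W 1)) \<and>
         (\<forall>\<psi> :: nat \<Rightarrow> real vec.
            (\<forall>i<k. \<psi> i \<in> carrier_vec (q i)) \<longrightarrow>
            right_singular_vector (concat_dtm k q r P W 1) (vconcat (map \<psi> [0..<k]))
              (second_singular_value (concat_dtm k q r P W 1)) \<longrightarrow>
            vconcat (map \<psi> [0..<k]) \<bullet> vconcat (map (sqrt_dist q P) [0..<k]) = 0 \<longrightarrow>
            k = 1 \<or> second_singular_value (concat_dtm k q r P W 1) \<noteq> 0 \<longrightarrow>
            (\<forall>i<k. \<psi> i \<bullet> sqrt_dist q P i = 0))"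
proof (intro conjI allI impI)
  define B where "B = dtm k q r P W"
  define u where "u = vec r (\<lambda>y. sqrt (output_dist k q P W y))"
  define v where "v = sqrt_dist q P"
  have u: "u \<in> carrier_vec r" unfolding u_def by simp
  have uc: "unit_contraction (transpose_mat (B i)) u (v i)" if "i < k" for i
    unfolding B_def u_def v_def using assms(2-6) that by (intro unit_contraction_transpose_dtm) auto
  have u1: "u \<bullet> u = 1" using unit_contractionD(4)[OF uc[of 0]] assms(1) by simp
  have c1: "concat_dtm k q r P W 1 = hconcat r (map B [0..<k])"
    unfolding concat_dtm_def B_def kron_pow_1 by (simp only: power_one_right)
  {
    fix n :: nat assume "1 \<le> n"
    then show "second_singular_value (concat_dtm k q r P W n)
        = second_singular_value (concat_dtm k q r P W 1)"
      unfolding c1 unfolding concat_dtm_def B_def[symmetric]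
      by (intro second_singular_value_hconcat_kron_pow[OF assms(1) u u1 _ uc])
  }
  fix \<psi> :: "nat \<Rightarrow> real vec" and i
  define A where "A = hconcat r (map B [0..<k])"
  define x where "x = vconcat (map \<psi> [0..<k])"
  define s where "s = second_singular_value A"
  assume psi: "\<forall>i<k. \<psi> i \<in> carrier_vec (q i)"
    and sv: "right_singular_vector (concat_dtm k q r P W 1) (vconcat (map \<psi> [0..<k]))
              (second_singular_value (concat_dtm k q r P W 1))"
    and perp: "vconcat (map \<psi> [0..<k]) \<bullet> vconcat (map (sqrt_dist q P) [0..<k]) = 0"
    and nz: "k = 1 \<or> second_singular_value (concat_dtm k q r P W 1) \<noteq> 0" and i: "i < k"
  have dv: "dim_vec (v j) = q j" for j unfolding v_def sqrt_dist_def by simp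
  have Bc: "B j \<in> carrier_mat r (q j)" for j unfolding B_def dtm_def by simp
  have A: "A \<in> carrier_mat r (dim_col A)"
    using carrier_matD(1)[OF hconcat_carrier[of "map B [0..<k]" r]] carrier_matD(1)[OF Bc]
    unfolding A_def by (intro carrier_matI) auto
  have tA: "transpose_mat A *\<^sub>v y = vconcat (map (\<lambda>j. transpose_mat (B j) *\<^sub>v y) [0..<k])"
    if "y \<in> carrier_vec r" for y
  proof -
    have "transpose_mat A *\<^sub>v y = vconcat (map (\<lambda>M. transpose_mat M *\<^sub>v y) (map B [0..<k]))"
      unfolding A_def by (rule transpose_hconcat_mult_vec) (use carrier_matD(1)[OF Bc] that in auto)
    then show ?thesis by (simp add: o_def)
  qed
  have "eigenvector (transpose_mat A * A) x (s\<^sup>2)"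
    using sv unfolding right_singular_vector_def c1 A_def x_def s_def by (rule conjunct2)
  then have x: "x \<in> carrier_vec (dim_col A)" and Sx: "(transpose_mat A * A) *\<^sub>v x = s\<^sup>2 \<cdot>\<^sub>v x"
    unfolding eigenvector_def by simp_all
  define z where "z = A *\<^sub>v x"
  have z: "z \<in> carrier_vec r" unfolding z_def by (rule mult_mat_vec_carrier[OF A x])
  \<comment> \<open>The orthogonality of \<open>x\<close> to the top right singular vector is moved
    to the output side, where it becomes orthogonality of \<open>z\<close> to
    \<open>u\<close>.\<close>
  have "u \<bullet> z = (transpose_mat A *\<^sub>v u) \<bullet> x"
    unfolding z_def by (rule transpose_vec_mult_scalar[OF A x u, symmetric])
  also have "transpose_mat A *\<^sub>v u = vconcat (map v [0..<k])"
    unfolding tA[OF u] using unit_contractionD(2)[OF uc] by (intro arg_cong[of _ _ vconcat]) auto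
  also have "\<dots> \<bullet> x = x \<bullet> vconcat (map v [0..<k])"
  proof -
    have "vconcat (map v [0..<k]) \<in> carrier_vec (\<Sum>j\<leftarrow>[0..<k]. q j)"
      using vconcat_carrier[of v "[0..<k]"] dv by simp
    moreover have "map (\<lambda>j. dim_vec (\<psi> j)) [0..<k] = map q [0..<k]" using psi by auto
    then have "x \<in> carrier_vec (\<Sum>j\<leftarrow>[0..<k]. q j)"
      unfolding x_def using vconcat_carrier[of \<psi> "[0..<k]"] by (simp only:)
    ultimately show ?thesis by (rule comm_scalar_prod)
  qed
  also have "\<dots> = 0" using perp unfolding x_def v_def .
  finally have uz: "u \<bullet> z = 0" .
  have "transpose_mat A *\<^sub>v z = s\<^sup>2 \<cdot>\<^sub>v x"
    unfolding z_def using Sx assoc_mult_mat_vec[OF transpose_carrier_mat[THEN iffD2, OF A] A x] by metis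
  then have "vconcat (map (\<lambda>j. transpose_mat (B j) *\<^sub>v z) [0..<k]) = vconcat (map (\<lambda>j. s\<^sup>2 \<cdot>\<^sub>v \<psi> j) [0..<k])"
    unfolding tA[OF z] x_def smult_vconcat .
  \<comment> \<open>Both stacked vectors have blocks of equal lengths, so the singular equation
    splits into one equation for each transmitter.\<close>
  then have Bz: "transpose_mat (B i) *\<^sub>v z = s\<^sup>2 \<cdot>\<^sub>v \<psi> i"
    by (rule vconcat_eqD) (use i psi carrier_matD(2)[OF Bc] in auto)
  have vi: "v i \<in> carrier_vec (q i)" using dv by (intro carrier_vecI)
  have "s\<^sup>2 * (\<psi> i \<bullet> v i) = (transpose_mat (B i) *\<^sub>v z) \<bullet> v i"
    unfolding Bz using psi i vi by simp
  also have "\<dots> = z \<bullet> u"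
    using transpose_vec_mult_scalar[OF Bc vi z] unit_contractionD(3)[OF uc[OF i]] by simp
  also have "\<dots> = 0" using uz comm_scalar_prod[OF u z] by simp
  finally have *: "s\<^sup>2 * (\<psi> i \<bullet> v i) = 0" .
  show "\<psi> i \<bullet> sqrt_dist q P i = 0"
  proof (cases "k = 1")
    \<comment> \<open>With one transmitter the stacked vector is its only block and
      \<open>perp\<close> is already the claim, also for singular value 0.\<close>
    case True
    then show ?thesis using perp psi i dv[of 0]
      vconcat_scalar_prod[of "[0..<k]" \<psi> "sqrt_dist q P"] by (simp add: sqrt_dist_def)
  next
    case False
    then show ?thesis using nz * unfolding c1 A_def[symmetric] s_def[symmetric] v_def by simp
  qed
qed

end
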